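(* In the Gaussian importance-weighting setting described in the context, consider a sequence of models indexed by $d'\to\infty$ with sample sizes $n=n(d')\to\infty$; the quantities $d$, $q$, $H$, $\Sigma_X$, and the numbers $\lambda_1,\dots,\lambda_{d'}$ may depend on $d'$. Assume: (A1) there is a positive constant $\delta$ (not depending on $d'$) such that $\frac{1}{\delta}\ge \lambda_j>\delta$ for all $1\le j\le d'$; (A2) $\tau_{d'}^2 := \frac{2}{d'}\sum_{j=1}^{d'}\left(3\lambda_j^4+2\lambda_j^2\right)\to\sigma^2$ for some constant $\sigma^2>0$. If $\frac{\log n\,\log d'}{d'}\to 0$, then the maximum weight $w_{(n)}=\max_{1\le i\le n}w_i$ satisfies $w_{(n)}\to 1$ in probability.
   Context: Data model: $Y=HX+\varepsilon$, where $Y$ is a $d\times 1$ random vector, $H$ is a known $d\times q$ matrix of rank $d'$, $X\sim N(0,\Sigma_X)$ is a $q\times1$ vector, and $\varepsilon\sim N(0,I_d)$ is independent of $X$. The sample $X_1,\dots,X_n$ is i.i.d. $N(0,\Sigma_X)$ and independent of $(X,\varepsilon)$. The importance weights are $$w_i=\frac{\exp\left(-\|Y-HX_i\|^2/2\right)}{\sum_{j=1}^n\exp\left(-\|Y-HX_j\|^2/2\right)},\qquad i=1,\dots,n,$$ where $\|\cdot\|$ is the Euclidean norm. The numbers $\lambda_1^2,\dots,\lambda_{d'}^2$ (with $\lambda_j>0$) denote the nonzero singular values (equivalently, eigenvalues), counted with multiplicity, of the covariance matrix $\mathrm{cov}(HX)=H\Sigma_XH^T$. Convergence in probability is with respect to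 the joint law of $X,\varepsilon,X_1,\dots,X_n$. *)

theory Defs
  imports
    "HOL-Probability.Probability"
    "Jordan_Normal_Form.Char_Poly"
    "Jordan_Normal_Form.DL_Rank"
begin

unbundle no vec_syntax and no fps_syntax

(* The dimensions vary along the sequence of models, so random vectors take values in the
   carrier-based vectors of Jordan_Normal_Form.  Their sigma-algebra on R^q is the one generated
   by the coordinates; only the measurable-space structure of this measure is used. *)
definition borel_vec :: "nat \<Rightarrow> real Matrix.vec measure" where
  "borel_vec q = vimage_algebra (carrier_vec q) (\<lambda>v. \<lambda>i\<in>{..<q}. v $ i) (PiM {..<q} (\<lambda>_. borel))"

definition std_normal_vec :: "nat \<Rightarrow> real Matrix.vec measure" where
  "std_normal_vec k =
     distr (PiM {..<k} (\<lambda>_. density lborel (\<lambda>x. ennreal (std_normal_density x)))) (borel_vec k) (Matrix.vec k)"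

(* "mu is the law N(0, C) on R^q": mu is the law of A Z, with Z standard normal in R^k and
   C = A A^T.  C may be singular. *)
definition centered_normal :: "nat \<Rightarrow> real mat \<Rightarrow> real Matrix.vec measure \<Rightarrow> bool" where
  "centered_normal q C \<mu> \<longleftrightarrow>
     (\<exists>k. \<exists>A\<in>carrier_mat q k. C = A * transpose_mat A \<and>
        \<mu> = distr (std_normal_vec k) (borel_vec q) (\<lambda>z. A *\<^sub>v z))"

(* the nonzero eigenvalues of A, counted with multiplicity, are l 1, ..., l k *)
definition nonzero_eigenvalues :: "real mat \<Rightarrow> nat \<Rightarrow> (nat \<Rightarrow> real) \<Rightarrow> bool" where
  "nonzero_eigenvalues A k l \<longleftrightarrow>
     {# a \<in># proots (char_poly A). a \<noteq> 0 #} = image_mset l (mset_set {1..k})"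

definition vec_nrm :: "real Matrix.vec \<Rightarrow> real" where
  "vec_nrm v = sqrt (\<Sum>i<dim_vec v. (v $ i)\<^sup>2)"

definition weight ::
  "real mat \<Rightarrow> nat \<Rightarrow> real Matrix.vec \<Rightarrow> (nat \<Rightarrow> real Matrix.vec) \<Rightarrow> nat \<Rightarrow> real" where
  "weight H n y x i =
     exp (- (vec_nrm (y - H *\<^sub>v x i))\<^sup>2 / 2) / (\<Sum>j=1..n. exp (- (vec_nrm (y - H *\<^sub>v x j))\<^sup>2 / 2))"

definition max_weight ::
  "real mat \<Rightarrow> nat \<Rightarrow> real Matrix.vec \<Rightarrow> (nat \<Rightarrow> real Matrix.vec) \<Rightarrow> real" where
  "max_weight H n y x = Max (weight H n y x ` {1..n})"

(* r is the rank of H (d' in the usual notation), C = cov(X), and S 1, ..., S n is the sample. *)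
locale gaussian_weighting_model = prob_space M
  for M :: "'a measure" +
  fixes d q r n :: nat
    and H C :: "real mat"
    and X \<epsilon> :: "'a \<Rightarrow> real Matrix.vec"
    and S :: "nat \<Rightarrow> 'a \<Rightarrow> real Matrix.vec"
  assumes H_carrier: "H \<in> carrier_mat d q"
    and rank_H: "vec_space.rank d H = r"
    and n_pos: "1 \<le> n"
    and law_X: "centered_normal q C (distr M (borel_vec q) X)"
    and law_\<epsilon>: "centered_normal d (1\<^sub>m d) (distr M (borel_vec d) \<epsilon>)"
    and law_S: "\<And>i. i \<in> {1..n} \<Longrightarrow> centered_normal q C (distr M (borel_vec q) (S i))"
    and indep_X_\<epsilon>: "indep_var (borel_vec q) X (borel_vec d) \<epsilon>"
    and indep_S: "indep_vars (\<lambda>_. borel_vec q) S {1..n}"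
    (* indep_var needs equal value types, so this one is stated for the generated sigma-algebras *)
    and indep_S_X_\<epsilon>: "indep_set
          (sets (vimage_algebra (space M) (\<lambda>\<omega>. \<lambda>i\<in>{1..n}. S i \<omega>) (PiM {1..n} (\<lambda>_. borel_vec q))))
          (sets (vimage_algebra (space M) (\<lambda>\<omega>. (X \<omega>, \<epsilon> \<omega>)) (borel_vec q \<Otimes>\<^sub>M borel_vec d)))"

(* the k-th variable lives on its own probability space M k *)
definition tends_to_in_probability ::
  "(nat \<Rightarrow> 'a measure) \<Rightarrow> (nat \<Rightarrow> 'a \<Rightarrow> real) \<Rightarrow> real \<Rightarrow> bool" where
  "tends_to_in_probability M Z c \<longleftrightarrow>
     (\<forall>e>0. (\<lambda>k. measure (M k) {\<omega> \<in> space (M k). \<bar>Z k \<omega> - c\<bar> > e}) \<longlonglongrightarrow> 0)"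

end

theory Submission
  imports Defs "Jordan_Normal_Form.Schur_Decomposition" "HOL-Real_Asymp.Real_Asymp"
begin

unbundle no inner_syntax

text \<open>
  Write \<open>m\<close> for the rank \<open>d'\<close>, and \<open>w i\<close> for the weights. Because they sum to one,
  \<open>1 - max w \<le> \<Sum>i. w i * (1 - w i)\<close>, and it suffices that the expectation of the right-hand side tends to
  zero, apart from a set of observations \<open>Y\<close> of small probability. Unlike the order statistics of the
  distances, this sum is accessible to Gaussian integration by parts.

  Fix \<open>Y\<close> and all samples but one. In the orthonormal eigenvectors \<open>u j\<close> of \<open>cov(HX)\<close> the remaining sample
  has the coordinates \<open>lam j * v j\<close> with \<open>v\<close> standard normal in dimension \<open>m\<close>, and the observation has the
  coordinates \<open>lam j * b j\<close>. Stein's identity for the functions \<open>(v j - b j) * w\<close>, summed over \<open>j\<close>, reads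
  \<open>E [w (1 - w) \<Sum>j. (lam j)\<^sup>2 (v j - b j)\<^sup>2] = E [w (m - |v|\<^sup>2 + b \<cdot> v)]\<close>.
  On the left the sum is at least of order \<open>m\<close>, because the \<open>lam j\<close> are bounded below and the
  lower tail of a noncentral chi-square variable is exponentially small (\<open>chi_square_lower_tail\<close>). On the
  right the factor of \<open>w\<close> is at most \<open>2 t m\<close> for any fixed \<open>t\<close> in \<open>(0, 1]\<close>, with exponentially small error, provided
  that \<open>|b|\<^sup>2 \<le> K m\<close>. Therefore \<open>E [w (1 - w)] \<le> 4 t / \<delta>\<^sup>2 * E w\<close> up to an exponentially small error
  (\<open>integral_W_le\<close>, \<open>single_sample_bound\<close>).

  Summed over the samples, the main terms add up to \<open>4 t / \<delta>\<^sup>2\<close>, and the errors are multiplied by \<open>n\<close>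
  (\<open>nn_integral_sum_weight_le\<close>). The growth condition gives \<open>ln n / m \<longlonglongrightarrow> 0\<close>, so the latter disappear in the
  limit. Finally \<open>|b|\<^sup>2 \<le> K m\<close> fails with probability at most of order \<open>1 / K\<close>
  (\<open>gaussian_weighting_tail_bound\<close>); \<open>K\<close> is chosen large first, and then \<open>t\<close> small.
\<close>

section \<open>Orthonormal eigenvectors of symmetric matrices\<close>

text \<open>
  Gram--Schmidt yields orthogonal columns only; normalising them makes the change of basis
  orthogonal, so that conjugating a symmetric matrix by it gives a symmetric matrix again.
\<close>

lemma orthonormal_matrix_with_first_column:
  fixes v :: "real Matrix.vec"
  assumes v: "v \<in> carrier_vec n" and v1: "v \<bullet> v = 1"
  obtains W where "W \<in> carrier_mat n n" "transpose_mat W * W = 1\<^sub>m n" "col W 0 = v" "0 < n"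
proof -
  have v0: "v \<noteq> 0\<^sub>v n" using v1 by auto
  have n: "0 < n" using v v0 by (cases n) auto
  interpret cof_vec_space n "TYPE(real)" .
  define b where "b = basis_completion v"
  from basis_completion[OF v v0, folded b_def]
  have dist_b: "distinct b" 
    and indep: "\<not> lin_dep (set b)" and b: "set b \<subseteq> carrier_vec n" and hdb: "hd b = v" 
    and len_b: "length b = n" by auto
  from hdb len_b n obtain vs where bv: "b = v # vs" by (cases b, auto)
  define ws where "ws = gram_schmidt n b"
  from gram_schmidt_result[OF b dist_b indep refl, folded ws_def]
  have ws: "set ws \<subseteq> carrier_vec n" "corthogonal ws" "length ws = n" 
    by (auto simp: len_b)
  from gram_schmidt_hd[OF v, of vs, folded bv] have hdws: "hd ws = v" unfolding ws_def .
  define W where "W = mat n n (\<lambda>(i, j). ws ! j $ i / sqrt (ws ! j \<bullet> ws ! j))"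
  have wsc: "ws ! j \<in> carrier_vec n" if "j < n" for j
    using ws that by (simp add: subset_iff)
  have orth: "ws ! i \<bullet> ws ! j = 0 \<longleftrightarrow> i \<noteq> j" if "i < n" "j < n" for i j
    using corthogonalD[OF ws(2), of i j] that ws(3) by simp
  have W: "W \<in> carrier_mat n n" by (simp add: W_def)
  have sp: "col W i \<bullet> col W j =
      (ws ! i \<bullet> ws ! j) / (sqrt (ws ! i \<bullet> ws ! i) * sqrt (ws ! j \<bullet> ws ! j))"
    if "i < n" "j < n" for i j
  proof -
    have "col W i \<bullet> col W j = (\<Sum>l<n. (ws ! i $ l / sqrt (ws ! i \<bullet> ws ! i)) * (ws ! j $ l / sqrt (ws ! j \<bullet> ws ! j)))"
      using that by (simp add: W_def scalar_prod_def lessThan_atLeast0)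
    also have "\<dots> = (\<Sum>l<n. ws ! i $ l * ws ! j $ l) / (sqrt (ws ! i \<bullet> ws ! i) * sqrt (ws ! j \<bullet> ws ! j))"
      by (simp add: sum_divide_distrib)
    also have "(\<Sum>l<n. ws ! i $ l * ws ! j $ l) = ws ! i \<bullet> ws ! j"
      using wsc[OF that(2)] by (simp add: scalar_prod_def lessThan_atLeast0)
    finally show ?thesis .
  qed
  have "transpose_mat W * W = 1\<^sub>m n"
  proof (rule eq_matI)
    fix i j assume ij: "i < dim_row (1\<^sub>m n :: real mat)" "j < dim_col (1\<^sub>m n :: real mat)"
    have nn: "ws ! i \<bullet> ws ! i \<ge> 0"
      by (simp add: scalar_prod_def sum_nonneg)
    show "(transpose_mat W * W) $$ (i, j) = 1\<^sub>m n $$ (i, j)"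
      using ij W sp[of i j] orth[of i j] orth[of i i] nn by (auto simp: real_sqrt_mult_self)
  qed (use W in auto)
  moreover have "col W 0 = v"
  proof (rule eq_vecI)
    fix i assume i: "i < dim_vec v"
    have "ws ! 0 = v" using hdws ws(3) n by (cases ws) auto
    then show "col W 0 $ i = v $ i" using i v v1 n by (simp add: W_def)
  qed (use v in \<open>simp add: W_def\<close>)
  ultimately show thesis using that W n by blast
qed

text \<open>
  Deflation. In an orthonormal basis that begins with an eigenvector, a symmetric matrix is block
  diagonal, and the remaining block is symmetric with the remaining roots. The induction is on the
  list of roots, which may be any part of the spectrum.
\<close>

lemma orthonormal_eigenvectors:
  fixes A :: "real mat"
  assumes "A \<in> carrier_mat n n" and "transpose_mat A = A"
    and "(\<Prod>e\<leftarrow>es. [:- e, 1:]) dvd char_poly A"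
  shows "\<exists>u. \<forall>j < length es. u j \<in> carrier_vec n \<and> A *\<^sub>v u j = (es ! j) \<cdot>\<^sub>v u j \<and>
            (\<forall>i < length es. u i \<bullet> u j = (if i = j then 1 else 0))"
  using assms
proof (induction es arbitrary: n A)
  case Nil
  then show ?case by simp
next
  case (Cons e es n A)
  note A = Cons.prems(1) and sym = Cons.prems(2)
  have "[:- e, 1:] dvd char_poly A" using Cons.prems(3) by (auto intro: dvd_mult_left)
  then have "eigenvalue A e"
    unfolding eigenvalue_root_char_poly[OF A] by (simp add: poly_eq_0_iff_dvd)
  then obtain v' where v': "v' \<in> carrier_vec n" "v' \<noteq> 0\<^sub>v n" "A *\<^sub>v v' = e \<cdot>\<^sub>v v'"
    using A by (auto simp: eigenvalue_def eigenvector_def)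
  define c where "c = v' \<bullet> v'"
  have c0: "c \<noteq> 0"
    using conjugate_square_eq_0_vec[OF v'(1)] v'(2) by (simp add: c_def)
  have c: "c > 0"
    using c0 by (simp add: c_def scalar_prod_def sum_nonneg less_le)
  define v where "v = (1 / sqrt c) \<cdot>\<^sub>v v'"
  have v: "v \<in> carrier_vec n" using v' by (simp add: v_def)
  have v1: "v \<bullet> v = 1"
    using v'(1) c by (simp add: v_def c_def[symmetric])
  have Av: "A *\<^sub>v v = e \<cdot>\<^sub>v v"
    unfolding v_def using A v' by (simp add: mult_mat_vec smult_smult_assoc mult.commute)
  obtain W where W: "W \<in> carrier_mat n n" and WW: "transpose_mat W * W = 1\<^sub>m n"
    and W0: "col W 0 = v" and n: "0 < n"
    using orthonormal_matrix_with_first_column[OF v v1] by blast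
  have WW': "W * transpose_mat W = 1\<^sub>m n"
    using mat_mult_left_right_inverse[OF _ W WW] W by simp
  define A' where "A' = transpose_mat W * A * W"
  have A': "A' \<in> carrier_mat n n" using W A by (simp add: A'_def)
  have sym': "transpose_mat A' = A'"
    unfolding A'_def using W A sym
    by (simp add: transpose_mult[of _ n n _ n] assoc_mult_mat[of _ n n _ n _ n])
  have sim: "similar_mat A' A"
    unfolding similar_mat_def
    by (rule exI[of _ "transpose_mat W"], rule exI[of _ W], rule similar_mat_witI[of _ _ n])
       (use W A A' WW WW' in \<open>auto simp: A'_def\<close>)
  have col0: "A' $$ (i, 0) = (if i = 0 then e else 0)" if "i < n" for i
  proof -
    have "A' $$ (i, 0) = (transpose_mat W * (A * W)) $$ (i, 0)"
      unfolding A'_def using W A by (simp add: assoc_mult_mat[of _ n n _ n _ n])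
    also have "\<dots> = col W i \<bullet> (A *\<^sub>v col W 0)"
      using W A that n by (simp add: mult_mat_vec_def)
    also have "\<dots> = e * (col W i \<bullet> col W 0)"
      using W v that by (simp add: W0 Av)
    also have "col W i \<bullet> col W 0 = (transpose_mat W * W) $$ (i, 0)"
      using W that n by simp
    also have "\<dots> = (if i = 0 then 1 else 0)" unfolding WW using that n by simp
    finally show ?thesis by simp
  qed
  \<comment> \<open>The first column of \<open>A'\<close> is \<open>(e, 0, ..., 0)\<close>, and by symmetry so is the first row.\<close>
  define B where "B = mat (n - 1) (n - 1) (\<lambda>(i, j). A' $$ (Suc i, Suc j))"
  have B: "B \<in> carrier_mat (n - 1) (n - 1)" by (simp add: B_def)
  have symA': "A' $$ (i, j) = A' $$ (j, i)" if "i < n" "j < n" for i j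
    using arg_cong[OF sym', of "\<lambda>M. M $$ (i, j)"] that A' by simp
  have block: "A' = four_block_mat (mat 1 1 (\<lambda>_. e)) (0\<^sub>m 1 (n - 1)) (0\<^sub>m (n - 1) 1) B"
  proof (rule eq_matI)
    fix i j assume "i < dim_row (four_block_mat (mat 1 1 (\<lambda>_. e)) (0\<^sub>m 1 (n - 1)) (0\<^sub>m (n - 1) 1) B)"
      "j < dim_col (four_block_mat (mat 1 1 (\<lambda>_. e)) (0\<^sub>m 1 (n - 1)) (0\<^sub>m (n - 1) 1) B)"
    then have ij: "i < n" "j < n" using n B by auto
    show "A' $$ (i, j) = four_block_mat (mat 1 1 (\<lambda>_. e)) (0\<^sub>m 1 (n - 1)) (0\<^sub>m (n - 1) 1) B $$ (i, j)"
      using ij B col0[of i] col0[of j] symA'[of i j]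
      by (auto simp: B_def four_block_mat_def Let_def)
  qed (use A' B n in auto)
  have symB: "transpose_mat B = B"
    by (rule eq_matI) (use symA' in \<open>auto simp: B_def\<close>)
  have "char_poly A = char_poly (mat 1 1 (\<lambda>_. e)) * char_poly B"
    unfolding char_poly_similar[OF sim, symmetric] block
    by (rule char_poly_four_block_zeros_col) (use B in auto)
  also have "char_poly (mat 1 1 (\<lambda>_. e)) = [:- e, 1:]"
    by (simp add: char_poly_defs det_def sign_def)
  finally have "(\<Prod>e\<leftarrow>es. [:- e, 1:]) dvd char_poly B"
    using Cons.prems(3) dvd_times_left_cancel_iff[of "[:- e, 1:]" "\<Prod>e\<leftarrow>es. [:- e, 1:]" "char_poly B"]
    by (simp only: list.map prod_list.Cons pCons_eq_0_iff one_neq_zero simp_thms not_False_eq_True)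
  from Cons.IH[OF B symB this] obtain u' where
    u': "\<And>j. j < length es \<Longrightarrow> u' j \<in> carrier_vec (n - 1)"
    and ev': "\<And>j. j < length es \<Longrightarrow> B *\<^sub>v u' j = (es ! j) \<cdot>\<^sub>v u' j"
    and on': "\<And>i j. i < length es \<Longrightarrow> j < length es \<Longrightarrow> u' i \<bullet> u' j = (if i = j then 1 else 0)"
    by blast
  \<comment> \<open>The eigenvectors of the block are padded by a leading zero; the first unit vector joins them.\<close>
  define x where "x j = (case j of 0 \<Rightarrow> vec 1 (\<lambda>_. 1) @\<^sub>v 0\<^sub>v (n - 1) | Suc i \<Rightarrow> 0\<^sub>v 1 @\<^sub>v u' i)" for j
  define o1 :: "real Matrix.vec" where "o1 = vec 1 (\<lambda>_. 1)"
  have o1: "o1 \<in> carrier_vec 1" "o1 \<bullet> o1 = 1" by (simp_all add: o1_def scalar_prod_def)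
  have x0: "x 0 = o1 @\<^sub>v 0\<^sub>v (n - 1)" and xS: "x (Suc i) = 0\<^sub>v 1 @\<^sub>v u' i" for i
    by (simp_all add: x_def o1_def)
  have z: "0\<^sub>v 1 \<in> carrier_vec 1" "0\<^sub>v (n - 1) \<in> carrier_vec (n - 1)" by auto
  have x: "x j \<in> carrier_vec n" if "j < length (e # es)" for j
  proof (cases j)
    case 0
    show ?thesis using append_carrier_vec[OF o1(1) z(2)] n unfolding 0 x0 by simp
  next
    case (Suc i)
    then have "i < length es" using that by simp
    from append_carrier_vec[OF z(1) u'[OF this]] show ?thesis using n unfolding Suc xS by simp
  qed
  have xx: "x i \<bullet> x j = (if i = j then 1 else 0)"
    if "i < length (e # es)" "j < length (e # es)" for i j
  proof (cases i; cases j)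
    assume "i = 0" "j = 0"
    then show ?thesis using scalar_prod_append[OF o1(1) z(2) o1(1) z(2)] o1 by (simp add: x0)
  next
    fix j' assume "i = 0" "j = Suc j'"
    then show ?thesis using scalar_prod_append[OF o1(1) z(2) z(1) u'[of j']] o1 u'[of j'] that by (simp add: x0 xS)
  next
    fix i' assume "i = Suc i'" "j = 0"
    then show ?thesis using scalar_prod_append[OF z(1) u'[of i'] o1(1) z(2)] o1 u'[of i'] that by (simp add: x0 xS)
  next
    fix i' j' assume "i = Suc i'" "j = Suc j'"
    then show ?thesis using scalar_prod_append[OF z(1) u'[of i'] z(1) u'[of j']] on'[of i' j'] that by (simp add: xS)
  qed
  have A1: "mat 1 1 (\<lambda>_. e) \<in> carrier_mat 1 1" by simp
  have A'x: "A' *\<^sub>v x j = ((e # es) ! j) \<cdot>\<^sub>v x j" if "j < length (e # es)" for j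
  proof (cases j)
    case 0
    have "A' *\<^sub>v x 0 = (mat 1 1 (\<lambda>_. e) *\<^sub>v o1 + 0\<^sub>m 1 (n - 1) *\<^sub>v 0\<^sub>v (n - 1)) @\<^sub>v
        (0\<^sub>m (n - 1) 1 *\<^sub>v o1 + B *\<^sub>v 0\<^sub>v (n - 1))"
      unfolding block x0 by (rule four_block_mat_mult_vec[OF A1 _ _ B o1(1) z(2)]) auto
    also have "\<dots> = e \<cdot>\<^sub>v x 0"
      unfolding x0 by (rule eq_vecI) (use B in \<open>auto simp: o1_def scalar_prod_def\<close>)
    finally show ?thesis using 0 by simp
  next
    case (Suc i)
    then have i: "i < length es" using that by simp
    have "A' *\<^sub>v x j = (mat 1 1 (\<lambda>_. e) *\<^sub>v 0\<^sub>v 1 + 0\<^sub>m 1 (n - 1) *\<^sub>v u' i) @\<^sub>v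
        (0\<^sub>m (n - 1) 1 *\<^sub>v 0\<^sub>v 1 + B *\<^sub>v u' i)"
      unfolding block xS Suc by (rule four_block_mat_mult_vec[OF A1 _ _ B z(1) u'[OF i]]) auto
    also have "\<dots> = (es ! i) \<cdot>\<^sub>v x j"
      unfolding ev'[OF i] Suc xS
      by (rule eq_vecI) (use u'[OF i] in \<open>auto simp: scalar_prod_def\<close>)
    finally show ?thesis using Suc by simp
  qed
  define u where "u j = W *\<^sub>v x j" for j
  have "u j \<in> carrier_vec n \<and> A *\<^sub>v u j = ((e # es) ! j) \<cdot>\<^sub>v u j \<and>
            (\<forall>i < length (e # es). u i \<bullet> u j = (if i = j then 1 else 0))"
    if j: "j < length (e # es)" for j
  proof (intro conjI allI impI)
    note xj = x[OF j]
    show "u j \<in> carrier_vec n" unfolding u_def by (rule mult_mat_vec_carrier[OF W xj])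
    have "A * W = W * A'"
    proof -
      have "W * A' = (W * transpose_mat W) * (A * W)"
        unfolding A'_def using W A by (simp add: assoc_mult_mat[of _ n n _ n _ n])
      then show ?thesis using W A by (simp add: WW')
    qed
    then have "A *\<^sub>v u j = W *\<^sub>v (A' *\<^sub>v x j)"
      unfolding u_def using assoc_mult_mat_vec[OF A W xj] assoc_mult_mat_vec[OF W A' xj] by (simp only:)
    then show "A *\<^sub>v u j = ((e # es) ! j) \<cdot>\<^sub>v u j"
      unfolding u_def A'x[OF j] by (simp only: mult_mat_vec[OF W xj])
    fix i assume i: "i < length (e # es)"
    have Wx: "W *\<^sub>v x j \<in> carrier_vec n" "W *\<^sub>v x i \<in> carrier_vec n"
      by (rule mult_mat_vec_carrier[OF W xj], rule mult_mat_vec_carrier[OF W x[OF i]])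
    have WT: "transpose_mat W \<in> carrier_mat n n" using W by simp
    have "u i \<bullet> u j = (W *\<^sub>v x j) \<bullet> (W *\<^sub>v x i)"
      unfolding u_def by (rule comm_scalar_prod[OF Wx(2,1)])
    also have "\<dots> = x i \<bullet> (transpose_mat W *\<^sub>v (W *\<^sub>v x j))"
      using transpose_vec_mult_scalar[OF W x[OF i] Wx(1)] comm_scalar_prod[OF x[OF i], of "transpose_mat W *\<^sub>v (W *\<^sub>v x j)"]
        mult_mat_vec_carrier[OF WT Wx(1)] by (simp only: u_def)
    also have "transpose_mat W *\<^sub>v (W *\<^sub>v x j) = x j"
      using assoc_mult_mat_vec[OF WT W xj] one_mult_mat_vec[OF xj] unfolding WW by (simp only:)
    finally show "u i \<bullet> u j = (if i = j then 1 else 0)" using xx[OF i j] by simp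
  qed
  then show ?case by blast
qed

lemma prod_linear_factors_dvd:
  fixes p :: "'a :: idom poly"
  assumes "p \<noteq> 0" "mset es \<subseteq># proots p"
  shows "(\<Prod>e\<leftarrow>es. [:- e, 1:]) dvd p"
  using assms
proof (induction es arbitrary: p)
  case (Cons e es)
  have "e \<in># proots p" using Cons.prems(2) by (auto dest: mset_subset_eqD)
  then obtain q where q: "p = [:- e, 1:] * q"
    using Cons.prems(1) by (auto simp: poly_eq_0_iff_dvd dvd_def)
  have "q \<noteq> 0" using Cons.prems(1) q by auto
  moreover have "proots p = add_mset e (proots q)"
    unfolding q using \<open>q \<noteq> 0\<close> by (subst proots_mult) (auto simp del: mult_pCons_left)
  then have "mset es \<subseteq># proots q" using Cons.prems(2) by simp
  ultimately have "(\<Prod>e\<leftarrow>es. [:- e, 1:]) dvd q" by (rule Cons.IH)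
  then have "[:- e, 1:] * (\<Prod>e\<leftarrow>es. [:- e, 1:]) dvd [:- e, 1:] * q" by (rule mult_dvd_mono[OF dvd_refl])
  then show ?case by (simp only: q list.map prod_list.Cons)
qed simp

lemma orthonormal_eigenvectors_of_nonzero_spectrum:
  fixes G :: "real mat"
  assumes G: "G \<in> carrier_mat n n" "transpose_mat G = G"
    and spec: "nonzero_eigenvalues G m l"
  shows "\<exists>u. \<forall>j<m. u j \<in> carrier_vec n \<and> G *\<^sub>v u j = l (Suc j) \<cdot>\<^sub>v u j \<and>
    (\<forall>i<m. u i \<bullet> u j = (if i = j then 1 else 0))"
proof -
  define es where "es = map l [1..<Suc m]"
  have "monic (char_poly G)" using degree_monic_char_poly[OF G(1)] by simp
  then have "char_poly G \<noteq> 0" by auto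
  moreover have "mset es = image_mset l (mset_set {1..m})"
    unfolding es_def mset_map by (simp only: mset_upt atLeastLessThanSuc_atLeastAtMost)
  then have "mset es \<subseteq># proots (char_poly G)"
    using spec unfolding nonzero_eigenvalues_def by (metis multiset_filter_subset)
  ultimately have "(\<Prod>e\<leftarrow>es. [:- e, 1:]) dvd char_poly G" by (rule prod_linear_factors_dvd)
  from orthonormal_eigenvectors[OF G this]
  show ?thesis by (simp add: es_def nth_append del: upt_Suc)
qed

section \<open>The standard Gaussian measure\<close>

definition std_gauss :: "nat \<Rightarrow> (nat \<Rightarrow> real) measure" where
  "std_gauss k = PiM {..<k} (\<lambda>_. std_normal_distribution)"

definition lin :: "nat \<Rightarrow> (nat \<Rightarrow> real) \<Rightarrow> (nat \<Rightarrow> real) \<Rightarrow> real" where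
  "lin k c z = (\<Sum>l<k. c l * z l)"

lemma prob_space_std_normal: "prob_space std_normal_distribution"
  by (rule prob_space_normal_density) simp

lemma product_sigma_finite_std_normal: "product_sigma_finite (\<lambda>_::nat. std_normal_distribution)"
  by (intro product_sigma_finite.intro prob_space_std_normal prob_space_imp_sigma_finite)

lemma prob_space_std_gauss: "prob_space (std_gauss k)"
  unfolding std_gauss_def by (rule prob_space_PiM) (rule prob_space_std_normal)

lemma measurable_std_gauss_component [measurable]:
  "l < k \<Longrightarrow> (\<lambda>z. z l) \<in> borel_measurable (std_gauss k)"
  unfolding std_gauss_def
  using measurable_component_singleton[of l "{..<k}" "\<lambda>_. std_normal_distribution"] by simp

lemma measurable_lin [measurable]: "lin k c \<in> borel_measurable (std_gauss k)"
  unfolding lin_def by measurable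

lemma lin_fun_upd:
  assumes "l < k"
  shows "lin k c (z(l := x)) = (lin k c z - c l * z l) + c l * x"
proof -
  have "lin k c (z(l := x)) = c l * x + (\<Sum>i\<in>{..<k} - {l}. c i * (z(l := x)) i)"
    unfolding lin_def using assms by (subst sum.remove[of _ l]) auto
  also have "(\<Sum>i\<in>{..<k} - {l}. c i * (z(l := x)) i) = (\<Sum>i\<in>{..<k} - {l}. c i * z i)"
    by (rule sum.cong) auto
  also have "\<dots> = lin k c z - c l * z l"
    unfolding lin_def using assms by (subst sum.remove[of _ l]) auto
  finally show ?thesis unfolding fun_upd_def by linarith
qed

section \<open>Gaussian integration by parts\<close>

lemma integrable_std_normal_quadratic_growth:
  fixes f :: "real \<Rightarrow> real"
  assumes [measurable]: "f \<in> borel_measurable borel"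
    and bound: "\<And>x. \<bar>f x\<bar> \<le> a * (1 + \<bar>x\<bar>)\<^sup>2"
  shows "integrable std_normal_distribution f"
    and "integrable std_normal_distribution (\<lambda>x. x * f x)"
proof -
  have m: "integrable std_normal_distribution (\<lambda>x. \<bar>x\<bar> ^ n)" for n
    using integrable_norm[OF integrable_std_normal_distribution_moment[of n]]
    by (simp add: power_abs)
  have "integrable std_normal_distribution (\<lambda>x. a * (\<bar>x\<bar>^0 + 2 * \<bar>x\<bar>^1 + \<bar>x\<bar>^2))"
    by (intro integrable_mult_right Bochner_Integration.integrable_add m)
  then show "integrable std_normal_distribution f"
  proof (rule Bochner_Integration.integrable_bound)
    show "AE x in std_normal_distribution. norm (f x) \<le> norm (a * (\<bar>x\<bar>^0 + 2 * \<bar>x\<bar>^1 + \<bar>x\<bar>^2))"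
    proof (intro AE_I2)
      fix x
      have "norm (f x) \<le> a * (\<bar>x\<bar>^0 + 2 * \<bar>x\<bar>^1 + \<bar>x\<bar>^2)"
        using bound[of x] by (simp add: power2_sum algebra_simps)
      then show "norm (f x) \<le> norm (a * (\<bar>x\<bar>^0 + 2 * \<bar>x\<bar>^1 + \<bar>x\<bar>^2))"
        unfolding real_norm_def by linarith
    qed
  qed simp
  have "integrable std_normal_distribution (\<lambda>x. a * (\<bar>x\<bar>^1 + 2 * \<bar>x\<bar>^2 + \<bar>x\<bar>^3))"
    by (intro integrable_mult_right Bochner_Integration.integrable_add m)
  then show "integrable std_normal_distribution (\<lambda>x. x * f x)"
  proof (rule Bochner_Integration.integrable_bound)
    have "\<bar>x\<bar> * \<bar>f x\<bar> \<le> a * (\<bar>x\<bar>^1 + 2 * \<bar>x\<bar>^2 + \<bar>x\<bar>^3)" for x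
    proof -
      have "\<bar>x\<bar> * \<bar>f x\<bar> \<le> \<bar>x\<bar> * (a * (1 + \<bar>x\<bar>)\<^sup>2)"
        using mult_left_mono[OF bound[of x], of "\<bar>x\<bar>"] by simp
      also have "\<dots> = a * (\<bar>x\<bar>^1 + 2 * \<bar>x\<bar>^2 + \<bar>x\<bar>^3)"
        by (simp only: power2_eq_square power3_eq_cube power_one_right) (simp only: algebra_simps mult_2)
      finally show ?thesis .
    qed
    then show "AE x in std_normal_distribution. norm (x * f x) \<le> norm (a * (\<bar>x\<bar>^1 + 2 * \<bar>x\<bar>^2 + \<bar>x\<bar>^3))"
      by (intro AE_I2) (metis abs_ge_self abs_mult order_trans real_norm_def)
  qed simp
qed

text \<open>
  If \<open>\<phi>\<close> is the standard normal density, then \<open>(f \<phi>)' = (f' - x f) \<phi>\<close>, and polynomial growth of \<open>f\<close>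
  makes \<open>f \<phi>\<close> vanish at both ends of the line.
\<close>

lemma stein_identity_1d:
  fixes f f' :: "real \<Rightarrow> real"
  assumes deriv: "\<And>x. (f has_real_derivative f' x) (at x)"
    and cont: "\<And>x. isCont f' x"
    and f: "\<And>x. \<bar>f x\<bar> \<le> a * (1 + \<bar>x\<bar>)\<^sup>2" and f': "\<And>x. \<bar>f' x\<bar> \<le> a' * (1 + \<bar>x\<bar>)\<^sup>2"
  shows "(\<integral>x. f' x \<partial>std_normal_distribution) = (\<integral>x. x * f x \<partial>std_normal_distribution)"
proof -
  have contf: "isCont f x" for x using deriv DERIV_isCont by blast
  have [measurable]: "f \<in> borel_measurable borel" "f' \<in> borel_measurable borel"
    by (auto intro!: borel_measurable_continuous_onI continuous_at_imp_continuous_on contf cont)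
  note int_f = integrable_std_normal_quadratic_growth(2)[of f, OF _ f, simplified]
  note int_f' = integrable_std_normal_quadratic_growth(1)[of f', OF _ f', simplified]
  let ?F = "\<lambda>x. f x * std_normal_density x"
  let ?F' = "\<lambda>x. (f' x - x * f x) * std_normal_density x"
  have d\<phi>: "(std_normal_density has_real_derivative - x * std_normal_density x) (at x)" for x
    unfolding std_normal_density_def
    by (auto intro!: derivative_eq_intros simp: field_simps)
  have dF: "(?F has_vector_derivative ?F' x) (at x)" for x
    unfolding has_real_derivative_iff_has_vector_derivative[symmetric]
    by (auto intro!: derivative_eq_intros deriv d\<phi> simp: algebra_simps)
  have cF': "isCont ?F' x" for x
    by (intro continuous_intros cont contf DERIV_isCont[OF d\<phi>])
  have i1: "integrable lborel (\<lambda>x. std_normal_density x *\<^sub>R f' x)"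
    using int_f' by (subst (asm) integrable_density) (auto simp: normal_density_nonneg)
  have i2: "integrable lborel (\<lambda>x. std_normal_density x *\<^sub>R (x * f x))"
    using int_f by (subst (asm) integrable_density) (auto simp: normal_density_nonneg)
  have eqF: "?F' = (\<lambda>x. std_normal_density x *\<^sub>R f' x - std_normal_density x *\<^sub>R (x * f x))"
    by (auto simp: algebra_simps)
  have iF': "integrable lborel ?F'" unfolding eqF using i1 i2 by auto
  have Fb: "norm (?F x) \<le> a * ((1 + \<bar>x\<bar>)\<^sup>2 * std_normal_density x)" for x
    using mult_right_mono[OF f[of x] normal_density_nonneg[of 0 1 x]] by (simp add: abs_mult normal_density_nonneg)
  have top: "((\<lambda>x. a * ((1 + \<bar>x\<bar>)\<^sup>2 * std_normal_density x)) \<longlongrightarrow> 0) at_top"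
    unfolding std_normal_density_def by real_asymp
  have bot: "((\<lambda>x. a * ((1 + \<bar>x\<bar>)\<^sup>2 * std_normal_density x)) \<longlongrightarrow> 0) at_bot"
    unfolding std_normal_density_def by real_asymp
  have F0: "(?F \<longlongrightarrow> 0) at_top" "(?F \<longlongrightarrow> 0) at_bot"
    by (rule Lim_null_comparison[OF always_eventually top], use Fb in blast,
        rule Lim_null_comparison[OF always_eventually bot], use Fb in blast)
  have "(LBINT x=-\<infinity>..\<infinity>. ?F' x) = 0 - 0"
  proof (rule interval_integral_FTC_integrable[where F = ?F])
    show "((?F \<circ> real_of_ereal) \<longlongrightarrow> 0) (at_right (- \<infinity>))" "((?F \<circ> real_of_ereal) \<longlongrightarrow> 0) (at_left \<infinity>)"
      by (simp_all add: ereal_tendsto_simps F0)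
  qed (use dF cF' iF' in \<open>auto simp: set_integrable_def\<close>)
  moreover have "(LBINT x=-\<infinity>..\<infinity>. ?F' x) = (\<integral>x. ?F' x \<partial>lborel)"
    by (simp add: interval_lebesgue_integral_def set_lebesgue_integral_def)
  moreover have "\<dots> = (\<integral>x. std_normal_density x *\<^sub>R f' x \<partial>lborel) - (\<integral>x. std_normal_density x *\<^sub>R (x * f x) \<partial>lborel)"
    unfolding eqF using i1 i2 by simp
  moreover have "(\<integral>x. std_normal_density x *\<^sub>R f' x \<partial>lborel) = (\<integral>x. f' x \<partial>std_normal_distribution)"
    by (subst integral_density) (auto simp: normal_density_nonneg)
  moreover have "(\<integral>x. std_normal_density x *\<^sub>R (x * f x) \<partial>lborel) = (\<integral>x. x * f x \<partial>std_normal_distribution)"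
    by (subst integral_density) (auto simp: normal_density_nonneg)
  ultimately show ?thesis by simp
qed

lemma stein_identity_coordinate:
  fixes f f' :: "(nat \<Rightarrow> real) \<Rightarrow> real"
  assumes l: "l < k"
    and deriv: "\<And>z x. ((\<lambda>x. f (z(l := x))) has_real_derivative f' (z(l := x))) (at x)"
    and cont: "\<And>z x. isCont (\<lambda>x. f' (z(l := x))) x"
    and f: "\<And>z. \<exists>a. \<forall>x. \<bar>f (z(l := x))\<bar> \<le> a * (1 + \<bar>x\<bar>)\<^sup>2"
    and f': "\<And>z. \<exists>a. \<forall>x. \<bar>f' (z(l := x))\<bar> \<le> a * (1 + \<bar>x\<bar>)\<^sup>2"
    and int_f: "integrable (std_gauss k) (\<lambda>z. z l * f z)"
    and int_f': "integrable (std_gauss k) f'"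
  shows "(\<integral>z. f' z \<partial>std_gauss k) = (\<integral>z. z l * f z \<partial>std_gauss k)"
proof -
  interpret product_sigma_finite "\<lambda>_::nat. std_normal_distribution"
    by (rule product_sigma_finite_std_normal)
  let ?I = "{..<k} - {l}"
  have G: "std_gauss k = PiM (insert l ?I) (\<lambda>_. std_normal_distribution)"
    using l by (simp add: std_gauss_def insert_absorb)
  have "(\<integral>z. f' z \<partial>std_gauss k) = (\<integral>z. (\<integral>x. f' (z(l := x)) \<partial>std_normal_distribution) \<partial>PiM ?I (\<lambda>_. std_normal_distribution))"
    unfolding G by (rule product_integral_insert) (use int_f'[unfolded G] in auto)
  also have "\<dots> = (\<integral>z. (\<integral>x. (z(l := x)) l * f (z(l := x)) \<partial>std_normal_distribution) \<partial>PiM ?I (\<lambda>_. std_normal_distribution))"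
  proof (rule Bochner_Integration.integral_cong[OF refl])
    fix z :: "nat \<Rightarrow> real"
    obtain a a' where "\<And>x. \<bar>f (z(l := x))\<bar> \<le> a * (1 + \<bar>x\<bar>)\<^sup>2" "\<And>x. \<bar>f' (z(l := x))\<bar> \<le> a' * (1 + \<bar>x\<bar>)\<^sup>2"
      using f f' by blast
    from stein_identity_1d[OF deriv cont this]
    show "(\<integral>x. f' (z(l := x)) \<partial>std_normal_distribution) = (\<integral>x. (z(l := x)) l * f (z(l := x)) \<partial>std_normal_distribution)"
      by simp
  qed
  also have "\<dots> = (\<integral>z. z l * f z \<partial>std_gauss k)"
    unfolding G by (rule product_integral_insert[symmetric]) (use int_f[unfolded G] in auto)
  finally show ?thesis .
qed

section \<open>Moments of the standard Gaussian measure\<close>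

lemma std_gauss_integral_prod:
  fixes f :: "nat \<Rightarrow> real \<Rightarrow> 'b::{real_normed_field,banach,second_countable_topology}"
  assumes "\<And>l. l < k \<Longrightarrow> integrable std_normal_distribution (f l)"
  shows "integrable (std_gauss k) (\<lambda>z. \<Prod>l<k. f l (z l))"
    and "(\<integral>z. (\<Prod>l<k. f l (z l)) \<partial>std_gauss k) = (\<Prod>l<k. \<integral>x. f l x \<partial>std_normal_distribution)"
proof -
  interpret product_sigma_finite "\<lambda>_::nat. std_normal_distribution"
    by (rule product_sigma_finite_std_normal)
  show "integrable (std_gauss k) (\<lambda>z. \<Prod>l<k. f l (z l))"
    unfolding std_gauss_def by (rule product_integrable_prod) (use assms in auto)
  show "(\<integral>z. (\<Prod>l<k. f l (z l)) \<partial>std_gauss k) = (\<Prod>l<k. \<integral>x. f l x \<partial>std_normal_distribution)"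
    unfolding std_gauss_def by (rule product_integral_prod) (use assms in auto)
qed

lemma std_gauss_covariance:
  assumes "i < k" "j < k"
  shows "integrable (std_gauss k) (\<lambda>z. z i * z j)"
    and "(\<integral>z. z i * z j \<partial>std_gauss k) = (if i = j then 1 else 0)"
proof -
  define f where "f l x = (if l = i then x else 1) * (if l = j then x else 1)" for l and x :: real
  have f_pow: "f l = (\<lambda>x. x ^ (of_bool (l = i) + of_bool (l = j)))" for l
    by (auto simp: f_def fun_eq_iff power2_eq_square)
  have int: "integrable std_normal_distribution (f l)" for l
    unfolding f_pow by (rule integrable_std_normal_distribution_moment)
  have eq: "(\<Prod>l<k. f l (z l)) = z i * z j" for z
    using assms unfolding f_def prod.distrib by (simp add: prod.delta)
  show "integrable (std_gauss k) (\<lambda>z. z i * z j)"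
    using std_gauss_integral_prod(1)[of k f, OF int] by (simp add: eq)
  interpret prob_space std_normal_distribution by (rule prob_space_std_normal)
  have m2: "(\<integral>x. x ^ 2 \<partial>std_normal_distribution) = 1"
    using std_normal_distribution_even_moments(1)[of 1] by simp
  have m1: "(\<integral>x. x \<partial>std_normal_distribution) = 0"
    using integral_std_normal_distribution_moment_odd[of 1] by simp
  have "(\<integral>z. z i * z j \<partial>std_gauss k) = (\<Prod>l<k. \<integral>x. f l x \<partial>std_normal_distribution)"
    using std_gauss_integral_prod(2)[of k f, OF int] by (simp add: eq)
  also have "\<dots> = (if i = j then 1 else 0)"
  proof (cases "i = j")
    case True
    then have "(\<integral>x. f l x \<partial>std_normal_distribution) = 1" for l
      using m2 prob_space by (cases "l = j") (simp_all add: f_def power2_eq_square)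
    then show ?thesis using True by simp
  next
    case False
    have "(\<integral>x. f i x \<partial>std_normal_distribution) = 0"
      using False by (simp add: f_def m1)
    then show ?thesis using False assms(1) by (auto intro!: prod_zero)
  qed
  finally show "(\<integral>z. z i * z j \<partial>std_gauss k) = (if i = j then 1 else 0)" .
qed

lemma std_gauss_lin_covariance:
  shows "integrable (std_gauss k) (\<lambda>z. lin k c z * lin k c' z)"
    and "(\<integral>z. lin k c z * lin k c' z \<partial>std_gauss k) = (\<Sum>l<k. c l * c' l)"
proof -
  have eq: "lin k c z * lin k c' z = (\<Sum>i<k. \<Sum>j<k. (c i * c' j) * (z i * z j))" for z
    by (simp add: lin_def sum_product algebra_simps)
  show "integrable (std_gauss k) (\<lambda>z. lin k c z * lin k c' z)"
    unfolding eq by (intro Bochner_Integration.integrable_sum integrable_mult_right std_gauss_covariance) auto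
  have "(\<integral>z. lin k c z * lin k c' z \<partial>std_gauss k) = (\<Sum>i<k. \<Sum>j<k. (c i * c' j) * (if i = j then 1 else 0))"
    unfolding eq
    by (subst Bochner_Integration.integral_sum, (intro Bochner_Integration.integrable_sum integrable_mult_right std_gauss_covariance; auto),
        intro sum.cong refl, subst Bochner_Integration.integral_sum, (intro integrable_mult_right std_gauss_covariance; auto),
        intro sum.cong refl, simp add: std_gauss_covariance)
  also have "\<dots> = (\<Sum>l<k. c l * c' l)" by (simp add: if_distrib cong: if_cong)
  finally show "(\<integral>z. lin k c z * lin k c' z \<partial>std_gauss k) = (\<Sum>l<k. c l * c' l)" .
qed

lemma std_gauss_char:
  "(\<integral>z. iexp (lin k c z) \<partial>std_gauss k) = complex_of_real (exp (- (\<Sum>l<k. (c l)\<^sup>2) / 2))"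
proof -
  interpret prob_space std_normal_distribution by (rule prob_space_std_normal)
  have int: "integrable std_normal_distribution (\<lambda>x. iexp (c l * x))" for l
    by (rule integrable_const_bound[of _ 1]) auto
  have "iexp (lin k c z) = (\<Prod>l<k. iexp (c l * z l))" for z
    unfolding lin_def by (simp add: sum_distrib_left exp_sum)
  then have "(\<integral>z. iexp (lin k c z) \<partial>std_gauss k) = (\<Prod>l<k. \<integral>x. iexp (c l * x) \<partial>std_normal_distribution)"
    using std_gauss_integral_prod(2)[of k "\<lambda>l x. iexp (c l * x)", OF int] by simp
  also have "\<dots> = (\<Prod>l<k. complex_of_real (exp (- (c l)\<^sup>2 / 2)))"
    using char_std_normal_distribution by (simp add: char_def fun_eq_iff)
  also have "\<dots> = complex_of_real (exp (- (\<Sum>l<k. (c l)\<^sup>2) / 2))"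
    by (simp add: exp_sum[symmetric] of_real_prod[symmetric] sum_negf sum_divide_distrib
        del: of_real_prod)
  finally show ?thesis .
qed

lemma std_gauss_mgf:
  shows "integrable (std_gauss k) (\<lambda>z. exp (lin k c z))"
    and "(\<integral>z. exp (lin k c z) \<partial>std_gauss k) = exp ((\<Sum>l<k. (c l)\<^sup>2) / 2)"
proof -
  have dens: "std_normal_density x * exp (a * x) = exp (a\<^sup>2 / 2) * normal_density a 1 x" for a x :: real
    unfolding normal_density_def
    by (simp add: exp_add[symmetric] field_simps power2_eq_square)
  have int: "integrable std_normal_distribution (\<lambda>x. exp (a * x))" for a :: real
    by (subst integrable_density) (auto simp: normal_density_nonneg dens)
  have val: "(\<integral>x. exp (a * x) \<partial>std_normal_distribution) = exp (a\<^sup>2 / 2)" for a :: real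
    by (subst integral_density) (auto simp: normal_density_nonneg dens integral_normal_density)
  have eq: "exp (lin k c z) = (\<Prod>l<k. exp (c l * z l))" for z
    unfolding lin_def by (simp add: exp_sum)
  show "integrable (std_gauss k) (\<lambda>z. exp (lin k c z))"
    unfolding eq by (rule std_gauss_integral_prod(1)) (rule int)
  show "(\<integral>z. exp (lin k c z) \<partial>std_gauss k) = exp ((\<Sum>l<k. (c l)\<^sup>2) / 2)"
    unfolding eq by (subst std_gauss_integral_prod(2)) (auto simp: int val exp_sum sum_divide_distrib)
qed

lemma std_gauss_exp_neg_square:
  assumes s: "0 \<le> s"
  shows "integrable (std_gauss k) (\<lambda>z. exp (- s * (\<Sum>l<k. (z l)\<^sup>2)))"
    and "(\<integral>z. exp (- s * (\<Sum>l<k. (z l)\<^sup>2)) \<partial>std_gauss k) = (1 / sqrt (1 + 2 * s)) ^ k"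
proof -
  define t where "t = 1 / sqrt (1 + 2 * s)"
  have t: "t > 0" "t\<^sup>2 = 1 / (1 + 2 * s)" using s by (auto simp: t_def power_divide)
  have dens: "std_normal_density x * exp (- s * x\<^sup>2) = t * normal_density 0 t x" for x :: real
  proof -
    have "sqrt (2 * pi * t\<^sup>2) = sqrt (2 * pi) * t" using t(1) by (simp add: real_sqrt_mult)
    moreover have "x\<^sup>2 / (2 * t\<^sup>2) = x\<^sup>2 / 2 + s * x\<^sup>2" using s by (simp add: t(2) field_simps)
    ultimately show ?thesis using t(1)
      by (simp add: normal_density_def exp_add[symmetric] field_simps)
  qed
  have int: "integrable std_normal_distribution (\<lambda>x. exp (- s * x\<^sup>2))"
    using t(1) by (subst integrable_density) (auto simp: normal_density_nonneg dens[simplified])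
  have val: "(\<integral>x. exp (- s * x\<^sup>2) \<partial>std_normal_distribution) = t"
    using t(1) by (subst integral_density) (auto simp: normal_density_nonneg dens[simplified] integral_normal_density)
  have eq: "exp (- s * (\<Sum>l<k. (z l)\<^sup>2)) = (\<Prod>l<k. exp (- s * (z l)\<^sup>2))" for z :: "nat \<Rightarrow> real"
    by (simp add: exp_sum[symmetric] sum_distrib_left sum_negf)
  show "integrable (std_gauss k) (\<lambda>z. exp (- s * (\<Sum>l<k. (z l)\<^sup>2)))"
    unfolding eq by (rule std_gauss_integral_prod(1)) (rule int)
  show "(\<integral>z. exp (- s * (\<Sum>l<k. (z l)\<^sup>2)) \<partial>std_gauss k) = (1 / sqrt (1 + 2 * s)) ^ k"
    unfolding eq by (subst std_gauss_integral_prod(2)) (use int val t_def in auto)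
qed

section \<open>Lower tails of chi-square variables\<close>

lemma measurable_std_gauss_component':
  "f \<in> measurable N (std_gauss k) \<Longrightarrow> l < k \<Longrightarrow> (\<lambda>x. f x l) \<in> borel_measurable N"
  by (rule measurable_compose[OF _ measurable_std_gauss_component])

lemma sum_squares_orthonormal_combination:
  fixes p :: "nat \<Rightarrow> nat \<Rightarrow> real"
  assumes orth: "\<And>i j. i < m \<Longrightarrow> j < m \<Longrightarrow> (\<Sum>l<k. p i l * p j l) = (if i = j then 1 else 0)"
  shows "(\<Sum>l<k. (\<Sum>j<m. g j * p j l)\<^sup>2) = (\<Sum>j<m. (g j)\<^sup>2)"
proof -
  have "(\<Sum>l<k. (\<Sum>j<m. g j * p j l)\<^sup>2) = (\<Sum>l<k. \<Sum>i<m. \<Sum>j<m. (g i * g j) * (p i l * p j l))"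
    unfolding power2_eq_square sum_product by (simp add: mult_ac)
  also have "\<dots> = (\<Sum>i<m. \<Sum>j<m. (g i * g j) * (\<Sum>l<k. p i l * p j l))"
    unfolding sum_distrib_left
    by (subst sum.swap, rule sum.cong[OF refl], rule sum.swap)
  also have "\<dots> = (\<Sum>i<m. \<Sum>j<m. (g i * g j) * (if i = j then 1 else 0))"
    by (intro sum.cong refl) (simp add: orth)
  also have "\<dots> = (\<Sum>j<m. (g j)\<^sup>2)"
    by (simp add: if_distrib power2_eq_square cong: if_cong)
  finally show ?thesis .
qed

lemma sum_lin: "(\<Sum>j<m. g j * lin k (p j) z) = lin k (\<lambda>l. \<Sum>j<m. g j * p j l) z"
  unfolding lin_def
  by (simp add: sum_distrib_left sum_distrib_right mult_ac) (rule sum.swap)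

text \<open>
  The projections \<open>lin k (p j)\<close> onto orthonormal vectors behave like independent standard normal
  variables. For this Laplace transform the reason is that \<open>exp (- s |x|\<^sup>2)\<close> is, after scaling, the
  characteristic function of a second standard Gaussian vector \<open>g\<close>. After exchanging the two integrals,
  \<open>z\<close> occurs linearly in the exponent, and orthonormality turns its contribution into
  \<open>exp (- s |g|\<^sup>2)\<close>. The shift \<open>b\<close> survives only as a phase, whence the bound is uniform in \<open>b\<close>.
\<close>

lemma exp_neg_shifted_square_le:
  fixes p :: "nat \<Rightarrow> nat \<Rightarrow> real"
  assumes orth: "\<And>i j. i < m \<Longrightarrow> j < m \<Longrightarrow> (\<Sum>l<k. p i l * p j l) = (if i = j then 1 else 0)"
    and s: "0 \<le> s"
  shows "(\<integral>z. exp (- s * (\<Sum>j<m. (lin k (p j) z - b j)\<^sup>2)) \<partial>std_gauss k) \<le> (1 / sqrt (1 + 2 * s)) ^ m"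
proof -
  interpret Z: prob_space "std_gauss k" by (rule prob_space_std_gauss)
  interpret G: prob_space "std_gauss m" by (rule prob_space_std_gauss)
  interpret pair_prob_space "std_gauss k" "std_gauss m" ..
  define \<sigma> where "\<sigma> = sqrt (2 * s)"
  have \<sigma>: "\<sigma>\<^sup>2 = 2 * s" using s by (simp add: \<sigma>_def)
  define \<Phi> where "\<Phi> z g = iexp (\<Sum>j<m. \<sigma> * (lin k (p j) z - b j) * g j)" for z g
  note [measurable (raw)] = measurable_std_gauss_component'
  have meas: "(\<lambda>(z, g). \<Phi> z g) \<in> borel_measurable (std_gauss k \<Otimes>\<^sub>M std_gauss m)"
    unfolding \<Phi>_def lin_def by measurable
  have int: "integrable (std_gauss k \<Otimes>\<^sub>M std_gauss m) (\<lambda>(z, g). \<Phi> z g)"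
    by (rule P.integrable_const_bound[of _ 1]) (use meas in \<open>auto simp: \<Phi>_def\<close>)
  have sq: "complex_of_real (exp (- s * (\<Sum>j<m. (lin k (p j) z - b j)\<^sup>2))) = (\<integral>g. \<Phi> z g \<partial>std_gauss m)" for z
  proof -
    have "(\<integral>g. \<Phi> z g \<partial>std_gauss m) = complex_of_real (exp (- (\<Sum>j<m. (\<sigma> * (lin k (p j) z - b j))\<^sup>2) / 2))"
      using std_gauss_char[of m "\<lambda>j. \<sigma> * (lin k (p j) z - b j)"] by (simp add: \<Phi>_def lin_def)
    also have "(\<Sum>j<m. (\<sigma> * (lin k (p j) z - b j))\<^sup>2) = 2 * s * (\<Sum>j<m. (lin k (p j) z - b j)\<^sup>2)"
      by (simp add: power_mult_distrib \<sigma> sum_distrib_left)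
    finally show ?thesis by simp
  qed
  have swap: "(\<integral>z. \<Phi> z g \<partial>std_gauss k) =
      iexp (- (\<Sum>j<m. \<sigma> * b j * g j)) * complex_of_real (exp (- s * (\<Sum>j<m. (g j)\<^sup>2)))" for g
  proof -
    define c where "c l = \<sigma> * (\<Sum>j<m. g j * p j l)" for l
    have lin_c: "(\<Sum>j<m. \<sigma> * lin k (p j) z * g j) = lin k c z" for z
      using sum_lin[of "\<lambda>j. \<sigma> * g j" k p z m] by (simp add: c_def[abs_def] sum_distrib_left mult_ac)
    have "\<Phi> z g = iexp (- (\<Sum>j<m. \<sigma> * b j * g j)) * iexp (lin k c z)" for z
      unfolding \<Phi>_def exp_add[symmetric] lin_c[symmetric]
      by (simp add: algebra_simps sum_subtractf)
    then have "(\<integral>z. \<Phi> z g \<partial>std_gauss k) =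
        iexp (- (\<Sum>j<m. \<sigma> * b j * g j)) * complex_of_real (exp (- (\<Sum>l<k. (c l)\<^sup>2) / 2))"
      by (simp add: std_gauss_char)
    also have "(\<Sum>l<k. (c l)\<^sup>2) = 2 * s * (\<Sum>j<m. (g j)\<^sup>2)"
      unfolding c_def power_mult_distrib \<sigma> sum_distrib_left[symmetric]
      by (simp add: sum_squares_orthonormal_combination[OF orth])
    finally show ?thesis by simp
  qed
  have "complex_of_real (\<integral>z. exp (- s * (\<Sum>j<m. (lin k (p j) z - b j)\<^sup>2)) \<partial>std_gauss k) =
      (\<integral>z. (\<integral>g. \<Phi> z g \<partial>std_gauss m) \<partial>std_gauss k)"
    unfolding sq[symmetric] by (rule integral_complex_of_real[symmetric])
  also have "\<dots> = (\<integral>g. (\<integral>z. \<Phi> z g \<partial>std_gauss k) \<partial>std_gauss m)"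
    by (rule Fubini_integral[OF int, symmetric])
  finally have eq: "complex_of_real (\<integral>z. exp (- s * (\<Sum>j<m. (lin k (p j) z - b j)\<^sup>2)) \<partial>std_gauss k) =
      (\<integral>g. iexp (- (\<Sum>j<m. \<sigma> * b j * g j)) * complex_of_real (exp (- s * (\<Sum>j<m. (g j)\<^sup>2))) \<partial>std_gauss m)"
    unfolding swap .
  have "(\<integral>z. exp (- s * (\<Sum>j<m. (lin k (p j) z - b j)\<^sup>2)) \<partial>std_gauss k) \<le>
      norm (complex_of_real (\<integral>z. exp (- s * (\<Sum>j<m. (lin k (p j) z - b j)\<^sup>2)) \<partial>std_gauss k))"
    by simp
  also have "\<dots> \<le> (\<integral>g. exp (- s * (\<Sum>j<m. (g j)\<^sup>2)) \<partial>std_gauss m)"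
    unfolding eq
    by (rule order_trans[OF integral_norm_bound]) (simp add: norm_mult)
  also have "\<dots> = (1 / sqrt (1 + 2 * s)) ^ m" by (rule std_gauss_exp_neg_square(2)[OF s])
  finally show ?thesis .
qed

lemma chi_square_lower_tail_rate:
  fixes t :: real
  assumes t: "0 < t" "t \<le> 1"
  shows "exp (t / 4 * ((1 - t) * real m)) * (1 / sqrt (1 + 2 * (t / 4))) ^ m \<le> exp (- (t\<^sup>2 * real m / 8))"
proof -
  have pos: "1 + t / 2 > 0" using t by simp
  have "t / 2 - (t / 2)\<^sup>2 \<le> ln (1 + t / 2)" by (rule ln_one_plus_pos_lower_bound) (use t in auto)
  then have "real m * (t / 2 - (t / 2)\<^sup>2) \<le> real m * ln (1 + t / 2)" by (rule mult_left_mono) simp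
  moreover have "(1 / sqrt (1 + 2 * (t / 4))) ^ m = exp (- (real m * ln (1 + t / 2) / 2))"
  proof -
    have "1 / sqrt (1 + 2 * (t / 4)) = exp (- ln (1 + t / 2) / 2)"
      using pos by (simp add: exp_minus exp_ln ln_sqrt[symmetric] divide_simps)
    then show ?thesis by (simp add: exp_of_nat_mult[symmetric])
  qed
  ultimately show ?thesis
    by (simp add: exp_add[symmetric] field_simps power2_eq_square)
qed

text \<open>
  The exponential Markov inequality with parameter \<open>t / 4\<close>. It gives the lower tail of a chi-square
  variable and, because the bound is uniform in the shift, that of every noncentral one as well.
\<close>

lemma chi_square_lower_tail:
  fixes p :: "nat \<Rightarrow> nat \<Rightarrow> real"
  assumes orth: "\<And>i j. i < m \<Longrightarrow> j < m \<Longrightarrow> (\<Sum>l<k. p i l * p j l) = (if i = j then 1 else 0)"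
    and t: "0 < t" "t \<le> 1"
  shows "measure (std_gauss k) {z \<in> space (std_gauss k). (\<Sum>j<m. (lin k (p j) z - b j)\<^sup>2) < (1 - t) * real m}
      \<le> exp (- (t\<^sup>2 * real m / 8))"
proof -
  interpret Z: prob_space "std_gauss k" by (rule prob_space_std_gauss)
  let ?Q = "\<lambda>z. \<Sum>j<m. (lin k (p j) z - b j)\<^sup>2"
  let ?A = "{z \<in> space (std_gauss k). ?Q z < (1 - t) * real m}"
  have [measurable]: "?A \<in> sets (std_gauss k)" by measurable
  have int: "integrable (std_gauss k) (\<lambda>z. exp (- (t / 4) * ?Q z))"
    by (rule Z.integrable_const_bound[of _ 1]) (use t in \<open>auto intro!: mult_nonneg_nonneg sum_nonneg\<close>)
  have "measure (std_gauss k) ?A = (\<integral>z. indicator ?A z \<partial>std_gauss k)" by simp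
  also have "\<dots> \<le> (\<integral>z. exp (t / 4 * ((1 - t) * real m)) * exp (- (t / 4) * ?Q z) \<partial>std_gauss k)"
  proof (rule integral_mono)
    show "integrable (std_gauss k) (\<lambda>z. indicator ?A z :: real)"
      by (rule Z.integrable_const_bound[of _ 1]) (auto simp: indicator_def)
    show "integrable (std_gauss k) (\<lambda>z. exp (t / 4 * ((1 - t) * real m)) * exp (- (t / 4) * ?Q z))"
      using int by (rule integrable_mult_right)
    fix z
    have "t / 4 * ?Q z \<le> t / 4 * ((1 - t) * real m)" if "?Q z < (1 - t) * real m"
      using that t by (intro mult_left_mono) auto
    then show "indicator ?A z \<le> exp (t / 4 * ((1 - t) * real m)) * exp (- (t / 4) * ?Q z)"
      by (auto simp: indicator_def exp_add[symmetric])
  qed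
  also have "\<dots> = exp (t / 4 * ((1 - t) * real m)) * (\<integral>z. exp (- (t / 4) * ?Q z) \<partial>std_gauss k)"
    by simp
  also have "\<dots> \<le> exp (t / 4 * ((1 - t) * real m)) * (1 / sqrt (1 + 2 * (t / 4))) ^ m"
    by (rule mult_left_mono[OF exp_neg_shifted_square_le]) (use orth t in auto)
  also have "\<dots> \<le> exp (- (t\<^sup>2 * real m / 8))" by (rule chi_square_lower_tail_rate[OF t])
  finally show ?thesis .
qed

section \<open>The weight of a single sample\<close>

lemma integrable_affine:
  shows "integrable (std_gauss k) (\<lambda>z. (lin k c z - a) * (lin k c' z - a'))"
proof -
  interpret prob_space "std_gauss k" by (rule prob_space_std_gauss)
  have lin: "integrable (std_gauss k) (lin k c)" for c
  proof (rule Bochner_Integration.integrable_bound)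
    show "integrable (std_gauss k) (\<lambda>z. 1 + lin k c z * lin k c z)"
      by (intro Bochner_Integration.integrable_add integrable_const std_gauss_lin_covariance)
    have "\<bar>x\<bar> \<le> 1 + x * x" for x :: real
    proof -
      have "0 \<le> (\<bar>x\<bar> - 1)\<^sup>2" by simp
      then have "2 * \<bar>x\<bar> \<le> 1 + x * x" by (simp add: power2_diff) (simp add: power2_eq_square)
      then show ?thesis by linarith
    qed
    then show "AE z in std_gauss k. norm (lin k c z) \<le> norm (1 + lin k c z * lin k c z)"
      by (intro AE_I2) (metis abs_ge_self order_trans real_norm_def)
  qed simp
  have "integrable (std_gauss k) (\<lambda>z. lin k c z * lin k c' z - a' * lin k c z - a * lin k c' z + a * a')"
    by (intro Bochner_Integration.integrable_add Bochner_Integration.integrable_diff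
        integrable_const integrable_mult_right lin std_gauss_lin_covariance)
  then show ?thesis by (simp add: algebra_simps)
qed

text \<open>
  One sample \<open>x = B z\<close> is compared with a fixed observation \<open>y\<close>, while the other samples enter only
  through the sum \<open>A\<close> of their unnormalised weights. The \<open>u j\<close> are the eigenvectors of \<open>B B\<^sup>T\<close> with
  eigenvalues \<open>(lam j)\<^sup>2\<close>, and the \<open>p j\<close> are the matching right singular vectors of \<open>B\<close>.
\<close>

locale gaussian_softmax =
  fixes k d m :: nat and B p u :: "nat \<Rightarrow> nat \<Rightarrow> real" and lam y :: "nat \<Rightarrow> real" and A :: real
  assumes orth: "\<And>i j. i < m \<Longrightarrow> j < m \<Longrightarrow> (\<Sum>l<k. p i l * p j l) = (if i = j then 1 else 0)"
    and Bp: "\<And>i j. i < d \<Longrightarrow> j < m \<Longrightarrow> (\<Sum>l<k. B i l * p j l) = lam j * u j i"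
    and uB: "\<And>l j. l < k \<Longrightarrow> j < m \<Longrightarrow> (\<Sum>i<d. u j i * B i l) = lam j * p j l"
    and lam_pos: "\<And>j. j < m \<Longrightarrow> 0 < lam j"
    and A_nonneg: "0 \<le> A"
begin

text \<open>
  \<open>W\<close> is the normalised weight of the sample, and \<open>b\<close> is the observation in the coordinates
  \<open>lin k (p j) z\<close> of the sample: the scalar product of \<open>u j\<close> with \<open>y - B z\<close> is \<open>lam j * (b j - lin k (p j) z)\<close>.
\<close>

definition "V z = (\<Sum>i<d. (y i - lin k (B i) z)\<^sup>2) / 2"
definition "W z = exp (- V z) / (exp (- V z) + A)"
definition "b j = (\<Sum>i<d. u j i * y i) / lam j"

lemma measurable_W [measurable]: "W \<in> borel_measurable (std_gauss k)"
  unfolding W_def[abs_def] V_def[abs_def] by measurable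

lemma W_bounds: "0 \<le> W z" "W z \<le> 1"
  using A_nonneg by (auto simp: W_def divide_simps add_pos_nonneg add_nonneg_nonneg)

lemma integrable_mult_W:
  assumes "integrable (std_gauss k) f"
  shows "integrable (std_gauss k) (\<lambda>z. f z * W z)" "integrable (std_gauss k) (\<lambda>z. f z * (W z * (1 - W z)))"
proof -
  have [measurable]: "f \<in> borel_measurable (std_gauss k)" using assms by auto
  show "integrable (std_gauss k) (\<lambda>z. f z * W z)"
    by (rule Bochner_Integration.integrable_bound[OF assms])
       (use W_bounds in \<open>auto simp: abs_mult intro!: mult_left_le\<close>)
  show "integrable (std_gauss k) (\<lambda>z. f z * (W z * (1 - W z)))"
    by (rule Bochner_Integration.integrable_bound[OF assms])
       (use W_bounds in \<open>auto simp: abs_mult intro!: mult_left_le mult_le_one\<close>)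
qed

lemma lin_B_direction:
  assumes j: "j < m"
  shows "(\<Sum>i<d. u j i * lin k (B i) z) = lam j * lin k (p j) z"
proof -
  have "(\<Sum>i<d. u j i * lin k (B i) z) = lin k (\<lambda>l. \<Sum>i<d. u j i * B i l) z"
    by (rule sum_lin)
  also have "\<dots> = lam j * lin k (p j) z"
    unfolding lin_def sum_distrib_left by (intro sum.cong refl) (simp add: uB j)
  finally show ?thesis .
qed

text \<open>
  The partial derivative of \<open>V\<close> in the coordinate \<open>l\<close>, written as an affine function of \<open>z\<close>; the form that
  the chain rule produces is the next lemma.
\<close>

definition "D l z = lin k (\<lambda>n. \<Sum>i<d. B i l * B i n) z - (\<Sum>i<d. B i l * y i)"

lemma D_eq: "D l z = (\<Sum>i<d. (lin k (B i) z - y i) * B i l)"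
  unfolding D_def sum_lin[symmetric] by (simp add: algebra_simps sum_subtractf)

lemma D_direction:
  assumes j: "j < m"
  shows "(\<Sum>l<k. p j l * D l z) = (lam j)\<^sup>2 * (lin k (p j) z - b j)"
proof -
  have "(\<Sum>l<k. p j l * D l z) = (\<Sum>i<d. (lin k (B i) z - y i) * (\<Sum>l<k. B i l * p j l))"
    unfolding D_eq sum_distrib_left by (subst sum.swap) (simp add: mult_ac)
  also have "\<dots> = lam j * (\<Sum>i<d. u j i * lin k (B i) z - u j i * y i)"
    by (simp add: Bp j sum_distrib_left algebra_simps)
  also have "\<dots> = lam j * (lam j * lin k (p j) z - (\<Sum>i<d. u j i * y i))"
    by (simp add: sum_subtractf lin_B_direction[OF j])
  also have "(\<Sum>i<d. u j i * y i) = lam j * b j" using lam_pos[OF j] by (simp add: b_def)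
  finally show ?thesis by (simp add: power2_eq_square algebra_simps)
qed

lemma deriv_lin:
  assumes "l < k"
  shows "((\<lambda>x. lin k c (z(l := x))) has_real_derivative c l) (at x)"
  unfolding lin_fun_upd[OF assms] by (auto intro!: derivative_eq_intros)

lemma deriv_W:
  assumes l: "l < k"
  shows "((\<lambda>x. W (z(l := x))) has_real_derivative
     - (D l (z(l := x)) * (W (z(l := x)) * (1 - W (z(l := x)))))) (at x)"
proof -
  have dV: "((\<lambda>x. V (z(l := x))) has_real_derivative D l (z(l := x))) (at x)"
    unfolding V_def D_eq
  proof -
    have "((\<lambda>x. (y i - lin k (B i) (z(l := x)))\<^sup>2) has_real_derivative
        2 * ((lin k (B i) (z(l := x)) - y i) * B i l)) (at x)" for i
      by (rule derivative_eq_intros deriv_lin[OF l] refl | simp add: algebra_simps)+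
    then have "((\<lambda>x. (\<Sum>i<d. (y i - lin k (B i) (z(l := x)))\<^sup>2)) has_real_derivative
        (\<Sum>i<d. 2 * ((lin k (B i) (z(l := x)) - y i) * B i l))) (at x)"
      by (intro DERIV_sum)
    from DERIV_cdivide[OF this, of 2]
    show "((\<lambda>x. (\<Sum>i<d. (y i - lin k (B i) (z(l := x)))\<^sup>2) / 2) has_real_derivative
        (\<Sum>i<d. (lin k (B i) (z(l := x)) - y i) * B i l)) (at x)"
      by (simp add: sum_distrib_left[symmetric])
  qed
  define E where "E = exp (- V (z(l := x)))"
  have E: "E > 0" "E + A > 0" using A_nonneg by (auto simp: E_def intro: add_pos_nonneg)
  have W: "W (z(l := x)) = E / (E + A)" by (simp add: W_def E_def)
  have "((\<lambda>x. W (z(l := x))) has_real_derivative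
     (- D l (z(l := x)) * E * (E + A) - E * (- D l (z(l := x)) * E)) / ((E + A) * (E + A))) (at x)"
    unfolding W_def E_def
    by (intro DERIV_divide) (use E in \<open>auto intro!: derivative_eq_intros dV simp: E_def\<close>)
  moreover have "(- D l (z(l := x)) * E * (E + A) - E * (- D l (z(l := x)) * E)) / ((E + A) * (E + A)) =
    - (D l (z(l := x)) * (W (z(l := x)) * (1 - W (z(l := x)))))"
    unfolding W using E by (simp add: divide_simps) (simp add: algebra_simps)
  ultimately show ?thesis by simp
qed

lemma linear_growth:
  assumes "l < k"
  shows "\<exists>a\<ge>0. \<forall>x. \<bar>lin k c (z(l := x)) - r\<bar> \<le> a * (1 + \<bar>x\<bar>)"
proof (intro exI conjI allI)
  fix x
  let ?q = "lin k c z - c l * z l - r"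
  have "\<bar>lin k c (z(l := x)) - r\<bar> \<le> \<bar>?q\<bar> + \<bar>c l\<bar> * \<bar>x\<bar>"
    unfolding lin_fun_upd[OF assms] by (simp add: abs_mult[symmetric])
  also have "\<dots> \<le> (\<bar>?q\<bar> + \<bar>c l\<bar>) * (1 + \<bar>x\<bar>)"
    by (simp add: algebra_simps)
  finally show "\<bar>lin k c (z(l := x)) - r\<bar> \<le> (\<bar>?q\<bar> + \<bar>c l\<bar>) * (1 + \<bar>x\<bar>)" .
qed simp

text \<open>
  Integration by parts along the field that moves the sample away from the observation in the
  direction \<open>p j\<close>, that is, for the function \<open>(lin k (p j) z - b j) * W z\<close>. Along this field \<open>V\<close> changes at
  the rate \<open>(lam j)\<^sup>2 * (lin k (p j) z - b j)\<^sup>2\<close> and \<open>W\<close> at \<open>- W (1 - W)\<close> times that rate, whereas the other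
  side is \<open>W\<close> times a quantity of mean zero.
\<close>

lemma stein_direction:
  assumes j: "j < m"
  shows "(\<integral>z. (lam j)\<^sup>2 * (lin k (p j) z - b j)\<^sup>2 * (W z * (1 - W z)) \<partial>std_gauss k) =
     (\<integral>z. (1 - lin k (p j) z * (lin k (p j) z - b j)) * W z \<partial>std_gauss k)"
proof -
  interpret prob_space "std_gauss k" by (rule prob_space_std_gauss)
  let ?v = "\<lambda>z. lin k (p j) z"
  define f where "f z = (?v z - b j) * W z" for z
  define f' where "f' l z = p j l * W z - (?v z - b j) * D l z * (W z * (1 - W z))" for l z
  have zl: "z l = lin k (\<lambda>i. if i = l then 1 else 0) z - 0" if "l < k" for z l
    using that by (simp add: lin_def if_distrib[of "\<lambda>x. x * _"] cong: if_cong)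
  have int_zf: "integrable (std_gauss k) (\<lambda>z. z l * f z)" if l: "l < k" for l
  proof -
    have "integrable (std_gauss k) (\<lambda>z. (z l * (?v z - b j)) * W z)"
      by (rule integrable_mult_W(1)) (subst zl[OF l], rule integrable_affine)
    then show ?thesis by (simp add: f_def mult_ac)
  qed
  have int_f': "integrable (std_gauss k) (f' l)" for l
    unfolding f'_def
    by (intro Bochner_Integration.integrable_diff integrable_mult_W integrable_const)
       (unfold D_def, rule integrable_affine)
  have coord: "(\<integral>z. f' l z \<partial>std_gauss k) = (\<integral>z. z l * f z \<partial>std_gauss k)" if l: "l < k" for l
  proof (rule stein_identity_coordinate[OF l])
    show df: "((\<lambda>x. f (z(l := x))) has_real_derivative f' l (z(l := x))) (at x)" for z x
      unfolding f_def f'_def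
      by (rule DERIV_cong[OF DERIV_mult'[OF DERIV_diff[OF deriv_lin[OF l] DERIV_const] deriv_W[OF l]]])
         (simp add: algebra_simps)
    have cl: "isCont (\<lambda>x. lin k c (z(l := x))) x" for c z x
      by (rule DERIV_isCont[OF deriv_lin[OF l]])
    have cW: "isCont (\<lambda>x. W (z(l := x))) x" for z x
      by (rule DERIV_isCont[OF deriv_W[OF l]])
    show "isCont (\<lambda>x. f' l (z(l := x))) x" for z x
      unfolding f'_def D_def by (intro continuous_intros cl cW)
    fix z
    obtain a where a: "a \<ge> 0" "\<And>x. \<bar>?v (z(l := x)) - b j\<bar> \<le> a * (1 + \<bar>x\<bar>)"
      using linear_growth[OF l] by blast
    obtain a' where a': "a' \<ge> 0" "\<And>x. \<bar>D l (z(l := x))\<bar> \<le> a' * (1 + \<bar>x\<bar>)"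
      using linear_growth[OF l] unfolding D_def by blast
    have one: "c \<le> c * (1 + \<bar>x\<bar>)" if "c \<ge> 0" for c x :: real
      using that by (simp add: algebra_simps)
    have W1: "\<bar>r * W z'\<bar> \<le> \<bar>r\<bar>" "\<bar>r * (W z' * (1 - W z'))\<bar> \<le> \<bar>r\<bar>" for r z'
      using W_bounds[of z'] by (auto simp: abs_mult intro!: mult_left_le mult_le_one)
    have "\<bar>f (z(l := x))\<bar> \<le> a * (1 + \<bar>x\<bar>)\<^sup>2" for x
    proof -
      have "\<bar>f (z(l := x))\<bar> \<le> a * (1 + \<bar>x\<bar>)"
        unfolding f_def using W1(1) a(2) by (rule order_trans)
      also have "\<dots> \<le> a * (1 + \<bar>x\<bar>) * (1 + \<bar>x\<bar>)" by (rule one) (use a in auto)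
      finally show ?thesis by (simp add: power2_eq_square)
    qed
    then show "\<exists>a. \<forall>x. \<bar>f (z(l := x))\<bar> \<le> a * (1 + \<bar>x\<bar>)\<^sup>2" by blast
    have "\<bar>f' l (z(l := x))\<bar> \<le> (\<bar>p j l\<bar> + a * a') * (1 + \<bar>x\<bar>)\<^sup>2" for x
    proof -
      have "\<bar>f' l (z(l := x))\<bar> \<le> \<bar>p j l\<bar> + \<bar>(?v (z(l := x)) - b j) * D l (z(l := x))\<bar>"
        unfolding f'_def by (rule order_trans[OF abs_triangle_ineq4 add_mono[OF W1(1) W1(2)]])
      also have "\<dots> \<le> \<bar>p j l\<bar> * (1 + \<bar>x\<bar>) * (1 + \<bar>x\<bar>) + (a * (1 + \<bar>x\<bar>)) * (a' * (1 + \<bar>x\<bar>))"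
        unfolding abs_mult
        by (intro add_mono mult_mono a a' order_trans[OF one one]) (use a a' in auto)
      also have "\<dots> = (\<bar>p j l\<bar> + a * a') * (1 + \<bar>x\<bar>)\<^sup>2"
        by (simp only: power2_eq_square) (simp only: distrib_left distrib_right mult_ac)
      finally show ?thesis .
    qed
    then show "\<exists>a. \<forall>x. \<bar>f' l (z(l := x))\<bar> \<le> a * (1 + \<bar>x\<bar>)\<^sup>2" by blast
  qed (use int_zf[OF l] int_f' in auto)
  have "(\<integral>z. ?v z * f z \<partial>std_gauss k) = (\<integral>z. (\<Sum>l<k. p j l * (z l * f z)) \<partial>std_gauss k)"
    by (simp add: lin_def sum_distrib_right sum_distrib_left mult_ac)
  also have "\<dots> = (\<Sum>l<k. p j l * (\<integral>z. z l * f z \<partial>std_gauss k))"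
    by (subst Bochner_Integration.integral_sum) (auto intro!: int_zf)
  also have "\<dots> = (\<Sum>l<k. p j l * (\<integral>z. f' l z \<partial>std_gauss k))"
    by (simp add: coord)
  also have "\<dots> = (\<integral>z. (\<Sum>l<k. p j l * f' l z) \<partial>std_gauss k)"
    by (subst Bochner_Integration.integral_sum) (auto intro!: int_f')
  also have "\<dots> = (\<integral>z. W z - (lam j)\<^sup>2 * (?v z - b j)\<^sup>2 * (W z * (1 - W z)) \<partial>std_gauss k)"
  proof (rule Bochner_Integration.integral_cong[OF refl])
    fix z
    have "(\<Sum>l<k. p j l * f' l z) =
        (\<Sum>l<k. p j l * p j l) * W z - (?v z - b j) * (\<Sum>l<k. p j l * D l z) * (W z * (1 - W z))"
      unfolding f'_def by (simp add: algebra_simps sum_subtractf sum.distrib sum_distrib_left sum_distrib_right)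
    then show "(\<Sum>l<k. p j l * f' l z) = W z - (lam j)\<^sup>2 * (?v z - b j)\<^sup>2 * (W z * (1 - W z))"
      by (simp add: orth[OF j j] D_direction[OF j] power2_eq_square mult_ac)
  qed
  finally have 1: "(\<integral>z. ?v z * f z \<partial>std_gauss k) =
      (\<integral>z. W z - (lam j)\<^sup>2 * (?v z - b j)\<^sup>2 * (W z * (1 - W z)) \<partial>std_gauss k)" .
  have iW: "integrable (std_gauss k) W"
    using integrable_mult_W(1)[OF integrable_const[of 1]] by simp
  have i2: "integrable (std_gauss k) (\<lambda>z. (lam j)\<^sup>2 * (?v z - b j)\<^sup>2 * (W z * (1 - W z)))"
    by (rule integrable_mult_W(2), rule integrable_mult_right) (unfold power2_eq_square, rule integrable_affine)
  have i3: "integrable (std_gauss k) (\<lambda>z. ?v z * f z)"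
  proof -
    have "integrable (std_gauss k) (\<lambda>z. (?v z - 0) * (?v z - b j) * W z)"
      by (rule integrable_mult_W(1)) (rule integrable_affine)
    then show ?thesis by (simp add: f_def mult_ac)
  qed
  have "(\<integral>z. (1 - ?v z * (?v z - b j)) * W z \<partial>std_gauss k) = (\<integral>z. W z - ?v z * f z \<partial>std_gauss k)"
    by (simp add: f_def algebra_simps)
  then show ?thesis using 1 iW i2 i3 by simp
qed

text \<open>
  Summing the integration by parts over \<open>j\<close>. On the left, \<open>W (1 - W)\<close> is multiplied by at least
  \<open>\<delta>\<^sup>2\<close> times a noncentral chi-square variable, and the latter is at least \<open>m / 2\<close> up to a set of exponentially small measure. On the
  right, \<open>W\<close> is multiplied by \<open>m - R + L\<close>, where \<open>R\<close> is a chi-square variable with mean \<open>m\<close> and \<open>L\<close> is a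
  centred Gaussian variable of variance at most \<open>K m\<close>; hence this factor is at most \<open>2 t m\<close>, again up to an
  exponentially small error. The part proportional to \<open>W\<close> is kept as it is, because the weights of all
  samples add up to one; only the remaining error terms will be multiplied by the sample size.
\<close>

lemma integral_W_le:
  assumes m: "0 < m" and \<delta>: "0 < \<delta>" "\<And>j. j < m \<Longrightarrow> \<delta> \<le> lam j"
    and t: "0 < t" "t \<le> 1" and K: "0 < K" and b: "(\<Sum>j<m. (b j)\<^sup>2) \<le> K * real m"
  shows "(\<integral>z. W z * (1 - W z) \<partial>std_gauss k) \<le> 4 * t / \<delta>\<^sup>2 * (\<integral>z. W z \<partial>std_gauss k) +
    (exp (- (real m / 32)) + 2 / \<delta>\<^sup>2 * (exp (- (t\<^sup>2 * real m / 8)) + K / (t * real m) * exp (- (t\<^sup>2 * real m / (2 * K)))))"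
proof -
  interpret prob_space "std_gauss k" by (rule prob_space_std_gauss)
  let ?E = "\<lambda>f. (\<integral>z. f z \<partial>std_gauss k)" and ?I = "integrable (std_gauss k)"
  let ?v = "\<lambda>j z. lin k (p j) z"
  define Q where "Q z = (\<Sum>j<m. (?v j z - b j)\<^sup>2)" for z
  define R where "R z = (\<Sum>j<m. (?v j z - 0)\<^sup>2)" for z
  define L where "L z = (\<Sum>j<m. b j * ?v j z)" for z
  have [measurable]: "Q \<in> borel_measurable (std_gauss k)" "R \<in> borel_measurable (std_gauss k)"
    "L \<in> borel_measurable (std_gauss k)"
    unfolding Q_def[abs_def] R_def[abs_def] L_def[abs_def] by measurable
  have iQ: "?I Q" and iR: "?I R" unfolding Q_def R_def power2_eq_square
    by (intro Bochner_Integration.integrable_sum integrable_affine)+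
  have L_lin: "L z = lin k (\<lambda>l. \<Sum>j<m. b j * p j l) z" for z unfolding L_def by (rule sum_lin)
  have iL: "?I L"
    unfolding L_def
    by (intro Bochner_Integration.integrable_sum integrable_mult_right)
       (use integrable_affine[of k _ 0 "\<lambda>_. 0" "- 1"] in \<open>simp add: lin_def\<close>)
  have iW: "?I W" and iWW: "?I (\<lambda>z. W z * (1 - W z))"
    using integrable_mult_W[OF integrable_const[of 1]] by simp_all
  have iS: "?I (\<lambda>z. (lam j)\<^sup>2 * (?v j z - b j)\<^sup>2 * (W z * (1 - W z)))" for j
    by (intro integrable_mult_W(2) integrable_mult_right) (unfold power2_eq_square, rule integrable_affine)
  have indI: "?I (indicat_real {z \<in> space (std_gauss k). P z})" if [measurable]: "Measurable.pred (std_gauss k) P" for P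
    by (rule integrable_const_bound[of _ 1]) (auto simp: indicator_def)
  have indE: "?E (indicat_real {z \<in> space (std_gauss k). P z}) = measure (std_gauss k) {z \<in> space (std_gauss k). P z}"
    if [measurable]: "Measurable.pred (std_gauss k) P" for P by simp

  have "?E (\<lambda>z. \<delta>\<^sup>2 * Q z * (W z * (1 - W z))) \<le>
      ?E (\<lambda>z. \<Sum>j<m. (lam j)\<^sup>2 * (?v j z - b j)\<^sup>2 * (W z * (1 - W z)))"
  proof (rule integral_mono)
    show "?I (\<lambda>z. \<delta>\<^sup>2 * Q z * (W z * (1 - W z)))"
      by (intro integrable_mult_W integrable_mult_right iQ)
    show "?I (\<lambda>z. \<Sum>j<m. (lam j)\<^sup>2 * (?v j z - b j)\<^sup>2 * (W z * (1 - W z)))"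
      by (intro Bochner_Integration.integrable_sum iS)
    fix z
    have "\<delta>\<^sup>2 * (?v j z - b j)\<^sup>2 * (W z * (1 - W z)) \<le> (lam j)\<^sup>2 * (?v j z - b j)\<^sup>2 * (W z * (1 - W z))"
      if "j < m" for j
      using \<delta> that W_bounds[of z] by (intro mult_right_mono power_mono) auto
    then show "\<delta>\<^sup>2 * Q z * (W z * (1 - W z)) \<le> (\<Sum>j<m. (lam j)\<^sup>2 * (?v j z - b j)\<^sup>2 * (W z * (1 - W z)))"
      unfolding Q_def sum_distrib_left sum_distrib_right by (intro sum_mono) auto
  qed
  also have "\<dots> = (\<Sum>j<m. ?E (\<lambda>z. (1 - ?v j z * (?v j z - b j)) * W z))"
    by (subst Bochner_Integration.integral_sum) (auto intro!: iS stein_direction sum.cong)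
  also have "\<dots> = ?E (\<lambda>z. (real m - R z + L z) * W z)"
  proof (subst Bochner_Integration.integral_sum[symmetric])
    show "?I (\<lambda>z. (1 - ?v j z * (?v j z - b j)) * W z)" for j
      by (intro integrable_mult_W Bochner_Integration.integrable_diff integrable_const)
         (use integrable_affine[of k "p j" 0 "p j" "b j"] in simp)
    have "(\<Sum>j<m. (1 - ?v j z * (?v j z - b j)) * W z) = (real m - R z + L z) * W z" for z
      unfolding sum_distrib_right[symmetric]
      by (simp add: R_def L_def algebra_simps sum_subtractf sum.distrib power2_eq_square)
    then show "?E (\<lambda>z. \<Sum>j<m. (1 - ?v j z * (?v j z - b j)) * W z) = ?E (\<lambda>z. (real m - R z + L z) * W z)"
      by simp
  qed
  finally have 1: "\<delta>\<^sup>2 * ?E (\<lambda>z. Q z * (W z * (1 - W z))) \<le> ?E (\<lambda>z. (real m - R z + L z) * W z)"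
    by (simp add: mult.assoc)

  \<comment> \<open>The choice \<open>t / K\<close> minimises the Chernoff bound for \<open>L > t m\<close> when the variance is \<open>K m\<close>.\<close>
  have expL: "?I (\<lambda>z. exp (t / K * (L z - t * real m)))"
    "?E (\<lambda>z. exp (t / K * (L z - t * real m))) \<le> exp (- (t\<^sup>2 * real m / (2 * K)))"
  proof -
    have tL: "exp (t / K * (L z - t * real m)) = exp (- (t\<^sup>2 * real m / K)) * exp (lin k (\<lambda>l. \<Sum>j<m. (t / K * b j) * p j l) z)" for z
      unfolding sum_lin[symmetric] exp_add[symmetric]
      by (simp add: L_def algebra_simps power2_eq_square sum_distrib_left)
    show "?I (\<lambda>z. exp (t / K * (L z - t * real m)))"
      unfolding tL by (intro integrable_mult_right std_gauss_mgf)
    have "?E (\<lambda>z. exp (t / K * (L z - t * real m))) =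
        exp (- (t\<^sup>2 * real m / K)) * exp ((\<Sum>j<m. (t / K * b j)\<^sup>2) / 2)"
      unfolding tL
      by (simp only: integral_mult_right_zero std_gauss_mgf(2) sum_squares_orthonormal_combination[OF orth])
    also have "(\<Sum>j<m. (t / K * b j)\<^sup>2) = (t / K)\<^sup>2 * (\<Sum>j<m. (b j)\<^sup>2)"
      by (simp add: power_mult_distrib sum_distrib_left power_divide)
    also have "\<dots> \<le> (t / K)\<^sup>2 * (K * real m)"
      using b by (intro mult_left_mono) auto
    also have "exp (- (t\<^sup>2 * real m / K)) * exp ((t / K)\<^sup>2 * (K * real m) / 2) = exp (- (t\<^sup>2 * real m / (2 * K)))"
      unfolding exp_add[symmetric] using K by (simp add: field_simps power2_eq_square)
    finally show "?E (\<lambda>z. exp (t / K * (L z - t * real m))) \<le> exp (- (t\<^sup>2 * real m / (2 * K)))"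
      by simp
  qed

  let ?AR = "{z \<in> space (std_gauss k). R z < (1 - t) * real m}"
  have "?E (\<lambda>z. (real m - R z + L z) * W z) \<le>
      ?E (\<lambda>z. 2 * t * real m * W z + real m * indicat_real ?AR z + K / t * exp (t / K * (L z - t * real m)))"
  proof (rule integral_mono)
    show "?I (\<lambda>z. (real m - R z + L z) * W z)"
      by (intro integrable_mult_W Bochner_Integration.integrable_diff Bochner_Integration.integrable_add integrable_const iR iL)
    show "?I (\<lambda>z. 2 * t * real m * W z + real m * indicat_real ?AR z + K / t * exp (t / K * (L z - t * real m)))"
      by (intro Bochner_Integration.integrable_add integrable_mult_right iW indI expL) measurable
    fix z assume z: "z \<in> space (std_gauss k)"
    have R0: "0 \<le> R z" unfolding R_def by (intro sum_nonneg) auto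
    have "(real m - R z) * W z \<le> t * real m * W z + real m * indicat_real ?AR z"
    proof (cases "R z < (1 - t) * real m")
      case True
      have "(real m - R z) * W z \<le> real m * W z" using R0 W_bounds[of z] by (intro mult_right_mono) auto
      also have "\<dots> \<le> real m * 1" using W_bounds[of z] by (intro mult_left_mono) auto
      finally show ?thesis using True z t W_bounds[of z] by (simp add: add_increasing)
    next
      case False
      then have "(real m - R z) * W z \<le> (t * real m) * W z"
        using W_bounds[of z] by (intro mult_right_mono) (auto simp: algebra_simps)
      then show ?thesis using False by simp
    qed
    moreover have "L z * W z \<le> t * real m * W z + K / t * exp (t / K * (L z - t * real m))"
    proof -
      let ?x = "L z - t * real m"
      \<comment> \<open>The bound \<open>x \<le> exp (s x) / s\<close> reduces the expected excess of \<open>L\<close> over \<open>t m\<close> to an exponential moment.\<close>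
      have "t / K * ?x \<le> exp (t / K * ?x)" using exp_ge_add_one_self[of "t / K * ?x"] by linarith
      then have x: "?x \<le> K / t * exp (t / K * ?x)" using t K by (simp add: field_simps)
      have "?x * W z \<le> K / t * exp (t / K * ?x)"
      proof (cases "?x \<ge> 0")
        case True
        then have "?x * W z \<le> ?x" using W_bounds[of z] by (intro mult_left_le) auto
        with x show ?thesis by simp
      next
        case False
        then have "?x * W z \<le> 0" using W_bounds[of z] by (intro mult_nonpos_nonneg) auto
        also have "0 \<le> K / t * exp (t / K * ?x)" using t K by simp
        finally show ?thesis .
      qed
      then show ?thesis by (simp add: algebra_simps)
    qed
    ultimately show "(real m - R z + L z) * W z \<le>
        2 * t * real m * W z + real m * indicat_real ?AR z + K / t * exp (t / K * (L z - t * real m))"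
      by (simp add: algebra_simps)
  qed
  also have "\<dots> = 2 * t * real m * ?E W + real m * measure (std_gauss k) ?AR + K / t * ?E (\<lambda>z. exp (t / K * (L z - t * real m)))"
  proof -
    have iAR: "?I (indicat_real ?AR)" by (rule indI) measurable
    have eAR: "?E (indicat_real ?AR) = measure (std_gauss k) ?AR" by (rule indE) measurable
    show ?thesis using iW iAR expL(1) by (simp add: eAR)
  qed
  also have "\<dots> \<le> 2 * t * real m * ?E W + real m * exp (- (t\<^sup>2 * real m / 8)) + K / t * exp (- (t\<^sup>2 * real m / (2 * K)))"
    using chi_square_lower_tail[of m p k t "\<lambda>_. 0", OF orth t] expL(2) t K
    by (intro add_mono mult_left_mono order_refl) (auto simp: R_def)
  finally have 2: "?E (\<lambda>z. (real m - R z + L z) * W z) \<le>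
      2 * t * real m * ?E W + real m * exp (- (t\<^sup>2 * real m / 8)) + K / t * exp (- (t\<^sup>2 * real m / (2 * K)))" .

  let ?AQ = "{z \<in> space (std_gauss k). Q z < (1 - 1 / 2) * real m}"
  have "?E (\<lambda>z. W z * (1 - W z)) \<le> ?E (\<lambda>z. 2 / real m * (Q z * (W z * (1 - W z))) + indicat_real ?AQ z)"
  proof (rule integral_mono)
    show "?I (\<lambda>z. W z * (1 - W z))" by fact
    show "?I (\<lambda>z. 2 / real m * (Q z * (W z * (1 - W z))) + indicat_real ?AQ z)"
      by (intro Bochner_Integration.integrable_add integrable_mult_right integrable_mult_W iQ indI) measurable
    fix z assume z: "z \<in> space (std_gauss k)"
    let ?w = "W z * (1 - W z)"
    have w: "0 \<le> ?w" "?w \<le> 1" using W_bounds[of z] by (auto intro!: mult_le_one)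
    have Q0: "0 \<le> Q z" unfolding Q_def by (intro sum_nonneg) auto
    show "?w \<le> 2 / real m * (Q z * ?w) + indicat_real ?AQ z"
    proof (cases "Q z < (1 - 1 / 2) * real m")
      case True
      then show ?thesis using w Q0 z by (simp add: add_increasing)
    next
      case False
      then have "1 * ?w \<le> (2 / real m * Q z) * ?w" using w m by (intro mult_right_mono) (auto simp: field_simps)
      then show ?thesis using False by (simp add: mult.assoc)
    qed
  qed
  also have "\<dots> = 2 / real m * ?E (\<lambda>z. Q z * (W z * (1 - W z))) + measure (std_gauss k) ?AQ"
  proof -
    have iAQ: "?I (indicat_real ?AQ)" by (rule indI) measurable
    have eAQ: "?E (indicat_real ?AQ) = measure (std_gauss k) ?AQ" by (rule indE) measurable
    show ?thesis using integrable_mult_W(2)[OF iQ] iAQ by (simp add: eAQ)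
  qed
  also have "\<dots> \<le> 2 / real m * (1 / \<delta>\<^sup>2 * (2 * t * real m * ?E W + real m * exp (- (t\<^sup>2 * real m / 8)) + K / t * exp (- (t\<^sup>2 * real m / (2 * K))))) + exp (- (real m / 32))"
  proof (intro add_mono mult_left_mono)
    show "measure (std_gauss k) ?AQ \<le> exp (- (real m / 32))"
      using chi_square_lower_tail[of m p k "1/2" b, OF orth] by (simp add: Q_def power2_eq_square)
    show "?E (\<lambda>z. Q z * (W z * (1 - W z))) \<le> 1 / \<delta>\<^sup>2 * (2 * t * real m * ?E W + real m * exp (- (t\<^sup>2 * real m / 8)) + K / t * exp (- (t\<^sup>2 * real m / (2 * K))))"
      using order_trans[OF 1 2] \<delta>(1) by (simp add: field_simps)
  qed simp
  also have "\<dots> = 4 * t / \<delta>\<^sup>2 * ?E W + (exp (- (real m / 32)) + 2 / \<delta>\<^sup>2 * (exp (- (t\<^sup>2 * real m / 8)) + K / (t * real m) * exp (- (t\<^sup>2 * real m / (2 * K)))))"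
    using m t \<delta>(1) by (simp add: field_simps)
  finally show ?thesis .
qed

end

section \<open>Normal laws on vectors of varying dimension\<close>

lemma space_borel_vec [simp]: "space (borel_vec q) = carrier_vec q"
  by (simp add: borel_vec_def)

lemma measurable_borel_vecI:
  assumes "\<And>x. x \<in> space N \<Longrightarrow> f x \<in> carrier_vec q"
    and "\<And>i. i < q \<Longrightarrow> (\<lambda>x. f x $ i) \<in> borel_measurable N"
  shows "f \<in> measurable N (borel_vec q)"
  unfolding borel_vec_def
  by (rule measurable_vimage_algebra2) (use assms in \<open>auto intro!: measurable_restrict\<close>)

lemma measurable_vec_index:
  assumes "i < q"
  shows "(\<lambda>v. v $ i) \<in> borel_measurable (borel_vec q)"
proof -
  have "(\<lambda>v. \<lambda>i\<in>{..<q}. v $ i) \<in> measurable (borel_vec q) (PiM {..<q} (\<lambda>_. borel))"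
    unfolding borel_vec_def by (rule measurable_vimage_algebra1) (auto simp: space_PiM)
  from measurable_compose[OF this measurable_component_singleton[of i]] assms
  show ?thesis by simp
qed

lemma measurable_vec_index' [measurable (raw)]:
  "f \<in> measurable N (borel_vec q) \<Longrightarrow> i < q \<Longrightarrow> (\<lambda>x. f x $ i) \<in> borel_measurable N"
  by (rule measurable_compose[OF _ measurable_vec_index])

lemma measurable_vec_std_gauss: "Matrix.vec k \<in> measurable (std_gauss k) (borel_vec k)"
  by (rule measurable_borel_vecI) auto

lemma measurable_mult_mat_vec [measurable (raw)]:
  assumes f: "f \<in> measurable N (borel_vec k)" and A: "A \<in> carrier_mat q k"
  shows "(\<lambda>x. A *\<^sub>v f x) \<in> measurable N (borel_vec q)"
proof (rule measurable_borel_vecI)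
  have fc: "f x \<in> carrier_vec k" if "x \<in> space N" for x
    using measurable_space[OF f that] by simp
  show "A *\<^sub>v f x \<in> carrier_vec q" if "x \<in> space N" for x
    using A fc[OF that] by simp
  fix i assume i: "i < q"
  have "(\<lambda>x. (A *\<^sub>v f x) $ i) \<in> borel_measurable N \<longleftrightarrow> (\<lambda>x. \<Sum>l<k. A $$ (i, l) * f x $ l) \<in> borel_measurable N"
  proof (rule measurable_cong)
    fix x assume "x \<in> space N"
    from fc[OF this] show "(A *\<^sub>v f x) $ i = (\<Sum>l<k. A $$ (i, l) * f x $ l)"
      using A i by (simp add: scalar_prod_def lessThan_atLeast0)
  qed
  then show "(\<lambda>x. (A *\<^sub>v f x) $ i) \<in> borel_measurable N" using f by simp
qed

lemma measurable_add_vec [measurable (raw)]: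
  assumes f: "f \<in> measurable N (borel_vec k)" and g: "g \<in> measurable N (borel_vec k)"
  shows "(\<lambda>x. f x + g x) \<in> measurable N (borel_vec k)"
proof (rule measurable_borel_vecI)
  have c: "f x \<in> carrier_vec k" "g x \<in> carrier_vec k" if "x \<in> space N" for x
    using measurable_space[OF f that] measurable_space[OF g that] by simp_all
  show "f x + g x \<in> carrier_vec k" if "x \<in> space N" for x using c[OF that] by simp
  fix i assume i: "i < k"
  have "(\<lambda>x. (f x + g x) $ i) \<in> borel_measurable N \<longleftrightarrow> (\<lambda>x. f x $ i + g x $ i) \<in> borel_measurable N"
  proof (rule measurable_cong)
    fix x assume "x \<in> space N"
    from c[OF this] i show "(f x + g x) $ i = f x $ i + g x $ i" by auto
  qed
  then show "(\<lambda>x. (f x + g x) $ i) \<in> borel_measurable N" using f g i by simp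
qed

lemma measurable_scalar_prod [measurable (raw)]:
  assumes f: "f \<in> measurable N (borel_vec k)"
  shows "(\<lambda>x. c \<bullet> f x) \<in> borel_measurable N"
proof -
  have "(\<lambda>x. c \<bullet> f x) \<in> borel_measurable N \<longleftrightarrow> (\<lambda>x. \<Sum>l<k. c $ l * f x $ l) \<in> borel_measurable N"
  proof (rule measurable_cong)
    fix x assume "x \<in> space N"
    with measurable_space[OF f] have "f x \<in> carrier_vec k" by simp
    then show "c \<bullet> f x = (\<Sum>l<k. c $ l * f x $ l)" by (simp add: scalar_prod_def lessThan_atLeast0)
  qed
  then show ?thesis using f by simp
qed

text \<open>
  The likelihood of the state \<open>x\<close> given the observation \<open>y\<close>, up to a constant that cancels in the weights.
\<close>

definition lik :: "real mat \<Rightarrow> real Matrix.vec \<Rightarrow> real Matrix.vec \<Rightarrow> real" where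
  "lik H y x = exp (- (vec_nrm (y - H *\<^sub>v x))\<^sup>2 / 2)"

lemma vec_nrm_diff_sq:
  assumes "H \<in> carrier_mat d q" "y \<in> carrier_vec d"
  shows "(vec_nrm (y - H *\<^sub>v x))\<^sup>2 = (\<Sum>i<d. (y $ i - (H *\<^sub>v x) $ i)\<^sup>2)"
proof -
  have "(vec_nrm (y - H *\<^sub>v x))\<^sup>2 = (\<Sum>i<d. ((y - H *\<^sub>v x) $ i)\<^sup>2)"
    unfolding vec_nrm_def using assms by (simp add: sum_nonneg)
  also have "\<dots> = (\<Sum>i<d. (y $ i - (H *\<^sub>v x) $ i)\<^sup>2)"
    by (rule sum.cong) (use assms in auto)
  finally show ?thesis .
qed

lemma measurable_lik [measurable (raw)]:
  assumes H: "H \<in> carrier_mat d q"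
    and f: "f \<in> measurable N (borel_vec d)" and g: "g \<in> measurable N (borel_vec q)"
  shows "(\<lambda>x. lik H (f x) (g x)) \<in> borel_measurable N"
proof -
  note [measurable] = f g measurable_mult_mat_vec[OF g H]
  have "(\<lambda>x. lik H (f x) (g x)) \<in> borel_measurable N \<longleftrightarrow>
      (\<lambda>x. exp (- (\<Sum>i<d. (f x $ i - (H *\<^sub>v g x) $ i)\<^sup>2) / 2)) \<in> borel_measurable N"
    by (rule measurable_cong) (use measurable_space[OF f] vec_nrm_diff_sq[OF H] in \<open>simp add: lik_def\<close>)
  also have "\<dots>" by measurable
  finally show ?thesis .
qed

lemma centered_normalE:
  assumes "centered_normal q C \<mu>"
  obtains k A where "A \<in> carrier_mat q k" "C = A * transpose_mat A"
    "(\<lambda>z. A *\<^sub>v Matrix.vec k z) \<in> measurable (std_gauss k) (borel_vec q)"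
    "\<mu> = distr (std_gauss k) (borel_vec q) (\<lambda>z. A *\<^sub>v Matrix.vec k z)"
proof -
  obtain k A where A: "A \<in> carrier_mat q k" "C = A * transpose_mat A"
    and \<mu>: "\<mu> = distr (std_normal_vec k) (borel_vec q) (\<lambda>z. A *\<^sub>v z)"
    using assms unfolding centered_normal_def by blast
  have m: "(\<lambda>z. A *\<^sub>v z) \<in> measurable (borel_vec k) (borel_vec q)"
    by (rule measurable_mult_mat_vec[OF _ A(1)]) simp
  show thesis
  proof (rule that[OF A])
    show "(\<lambda>z. A *\<^sub>v Matrix.vec k z) \<in> measurable (std_gauss k) (borel_vec q)"
      by (rule measurable_compose[OF measurable_vec_std_gauss m])
    show "\<mu> = distr (std_gauss k) (borel_vec q) (\<lambda>z. A *\<^sub>v Matrix.vec k z)"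
      unfolding \<mu> std_normal_vec_def std_gauss_def[symmetric]
      using m measurable_vec_std_gauss by (subst distr_distr) (auto simp: comp_def)
  qed
qed

lemma mult_mat_vec_vec_eq_lin:
  assumes "A \<in> carrier_mat q k" "i < q"
  shows "(A *\<^sub>v Matrix.vec k z) $ i = lin k (\<lambda>l. A $$ (i, l)) z"
  using assms by (simp add: lin_def scalar_prod_def lessThan_atLeast0)

lemma scalar_prod_mult_vec_eq_lin:
  assumes A: "A \<in> carrier_mat q k" and c: "c \<in> carrier_vec q"
  shows "c \<bullet> (A *\<^sub>v Matrix.vec k z) = lin k (\<lambda>l. (transpose_mat A *\<^sub>v c) $ l) z"
proof -
  have "c \<bullet> (A *\<^sub>v Matrix.vec k z) = (\<Sum>i<q. c $ i * lin k (\<lambda>l. A $$ (i, l)) z)"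
    using A by (simp add: scalar_prod_def[of c] lessThan_atLeast0 mult_mat_vec_vec_eq_lin[OF A] del: index_mult_mat_vec)
  also have "\<dots> = lin k (\<lambda>l. \<Sum>i<q. c $ i * A $$ (i, l)) z" by (rule sum_lin)
  also have "\<dots> = lin k (\<lambda>l. (transpose_mat A *\<^sub>v c) $ l) z"
    unfolding lin_def using A c by (intro sum.cong refl) (simp add: scalar_prod_def lessThan_atLeast0 mult.commute)
  finally show ?thesis .
qed

lemma scalar_prod_gram:
  fixes A :: "real mat"
  assumes A: "A \<in> carrier_mat q k" and c: "c \<in> carrier_vec q" "c' \<in> carrier_vec q"
  shows "(\<Sum>l<k. (transpose_mat A *\<^sub>v c) $ l * (transpose_mat A *\<^sub>v c') $ l) = c \<bullet> ((A * transpose_mat A) *\<^sub>v c')"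
proof -
  have T: "transpose_mat A \<in> carrier_mat k q" using A by simp
  have "(\<Sum>l<k. (transpose_mat A *\<^sub>v c) $ l * (transpose_mat A *\<^sub>v c') $ l) =
      (transpose_mat A *\<^sub>v c) \<bullet> (transpose_mat A *\<^sub>v c')"
    using A by (simp add: scalar_prod_def[of _ "_ *\<^sub>v _"] lessThan_atLeast0 del: index_mult_mat_vec)
  also have "\<dots> = c \<bullet> (A *\<^sub>v (transpose_mat A *\<^sub>v c'))"
    by (rule transpose_vec_mult_scalar[OF A mult_mat_vec_carrier[OF T c(2)] c(1)])
  also have "A *\<^sub>v (transpose_mat A *\<^sub>v c') = (A * transpose_mat A) *\<^sub>v c'"
    using assoc_mult_mat_vec[OF A T c(2)] by simp
  finally show ?thesis .
qed

lemma centered_normal_second_moment: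
  assumes \<mu>: "centered_normal q C \<mu>" and c: "c \<in> carrier_vec q"
  shows "(\<integral>\<^sup>+x. ennreal ((c \<bullet> x)\<^sup>2) \<partial>\<mu>) = ennreal (c \<bullet> (C *\<^sub>v c))"
proof -
  obtain k A where A: "A \<in> carrier_mat q k" "C = A * transpose_mat A"
    and m: "(\<lambda>z. A *\<^sub>v Matrix.vec k z) \<in> measurable (std_gauss k) (borel_vec q)"
    and \<mu>': "\<mu> = distr (std_gauss k) (borel_vec q) (\<lambda>z. A *\<^sub>v Matrix.vec k z)"
    using centered_normalE[OF \<mu>] .
  let ?c = "\<lambda>l. (transpose_mat A *\<^sub>v c) $ l"
  have "(\<integral>\<^sup>+x. ennreal ((c \<bullet> x)\<^sup>2) \<partial>\<mu>) = (\<integral>\<^sup>+z. ennreal (lin k ?c z * lin k ?c z) \<partial>std_gauss k)"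
    unfolding \<mu>' by (subst nn_integral_distr[OF m]) (simp_all add: scalar_prod_mult_vec_eq_lin[OF A(1) c] power2_eq_square del: index_mult_mat_vec)
  also have "\<dots> = ennreal (\<integral>z. lin k ?c z * lin k ?c z \<partial>std_gauss k)"
    by (rule nn_integral_eq_integral[OF std_gauss_lin_covariance(1)]) simp
  also have "(\<integral>z. lin k ?c z * lin k ?c z \<partial>std_gauss k) = c \<bullet> (C *\<^sub>v c)"
    unfolding std_gauss_lin_covariance(2) A(2) by (rule scalar_prod_gram[OF A(1) c c])
  finally show ?thesis .
qed

lemma centered_normal_prob_space:
  assumes "centered_normal q C \<mu>"
  shows "prob_space \<mu>" and "sets \<mu> = sets (borel_vec q)"
proof -
  obtain k A where A: "(\<lambda>z. A *\<^sub>v Matrix.vec k z) \<in> measurable (std_gauss k) (borel_vec q)"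
    "\<mu> = distr (std_gauss k) (borel_vec q) (\<lambda>z. A *\<^sub>v Matrix.vec k z)"
    using centered_normalE[OF assms] by metis
  interpret prob_space "std_gauss k" by (rule prob_space_std_gauss)
  show "prob_space \<mu>" "sets \<mu> = sets (borel_vec q)"
    unfolding A(2) using prob_space_distr[OF A(1)] by simp_all
qed

section \<open>The weights of a sample\<close>

text \<open>
  The error term of \<open>integral_W_le\<close>. Each of its summands is exponentially small in \<open>m\<close>, so that it may be
  multiplied by the sample size.
\<close>

definition single_error :: "real \<Rightarrow> real \<Rightarrow> real \<Rightarrow> nat \<Rightarrow> real" where
  "single_error \<delta> t K m = exp (- (real m / 32)) +
     2 / \<delta>\<^sup>2 * (exp (- (t\<^sup>2 * real m / 8)) + K / (t * real m) * exp (- (t\<^sup>2 * real m / (2 * K))))"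

text \<open>
  The bound for one sample, carried over to an arbitrary representation of its law. With
  \<open>B = H A\<close>, where \<open>A\<close> is the factor of the covariance, \<open>B B\<^sup>T\<close> equals \<open>H C H\<^sup>T\<close> whichever factor \<open>A\<close> was
  chosen, and the vectors \<open>B\<^sup>T u j / lam j\<close> are orthonormal.
\<close>

lemma single_sample_bound:
  fixes u :: "nat \<Rightarrow> real Matrix.vec" and lam :: "nat \<Rightarrow> real" and y :: "real Matrix.vec"
  assumes \<mu>: "centered_normal q C \<mu>" and H: "H \<in> carrier_mat d q"
    and u: "\<And>j. j < m \<Longrightarrow> u j \<in> carrier_vec d"
    and eig: "\<And>j. j < m \<Longrightarrow> (H * C * transpose_mat H) *\<^sub>v u j = (lam j)\<^sup>2 \<cdot>\<^sub>v u j"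
    and orth: "\<And>i j. i < m \<Longrightarrow> j < m \<Longrightarrow> u i \<bullet> u j = (if i = j then 1 else 0)"
    and m: "0 < m" and \<delta>: "0 < \<delta>" "\<And>j. j < m \<Longrightarrow> \<delta> \<le> lam j"
    and t: "0 < t" "t \<le> 1" and K: "0 < K"
    and y: "y \<in> carrier_vec d" and b: "(\<Sum>j<m. (u j \<bullet> y / lam j)\<^sup>2) \<le> K * real m"
    and A0: "0 \<le> A0"
  shows "(\<integral>x. lik H y x / (lik H y x + A0) * (1 - lik H y x / (lik H y x + A0)) \<partial>\<mu>) \<le>
      4 * t / \<delta>\<^sup>2 * (\<integral>x. lik H y x / (lik H y x + A0) \<partial>\<mu>) + single_error \<delta> t K m"
proof -
  obtain k A where A: "A \<in> carrier_mat q k" "C = A * transpose_mat A"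
    and meas: "(\<lambda>z. A *\<^sub>v Matrix.vec k z) \<in> measurable (std_gauss k) (borel_vec q)"
    and \<mu>': "\<mu> = distr (std_gauss k) (borel_vec q) (\<lambda>z. A *\<^sub>v Matrix.vec k z)"
    using centered_normalE[OF \<mu>] .
  define B where "B = H * A"
  have B: "B \<in> carrier_mat d k" using H A by (simp add: B_def)
  have BT: "transpose_mat B \<in> carrier_mat k d" using B by simp
  have G: "B * transpose_mat B = H * C * transpose_mat H"
    unfolding B_def A(2) using H A
    by (simp add: transpose_mult[OF H A(1)] assoc_mult_mat[of _ d k _ q _ d] assoc_mult_mat[of _ d q _ k _ d]
        assoc_mult_mat[of _ q k _ q _ d] assoc_mult_mat[of _ d q _ q _ d])
  have lam: "lam j > 0" if "j < m" for j using \<delta> that by force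
  define Bf where "Bf i l = B $$ (i, l)" for i l
  define p where "p j l = (transpose_mat B *\<^sub>v u j) $ l / lam j" for j l
  have BTu: "(transpose_mat B *\<^sub>v u j) $ l = (\<Sum>i<d. u j $ i * Bf i l)" if "l < k" "j < m" for j l
    using that B u[OF that(2)] by (simp add: Bf_def scalar_prod_def lessThan_atLeast0 mult.commute)
  interpret gaussian_softmax k d m Bf p "\<lambda>j i. u j $ i" lam "\<lambda>i. y $ i" A0
  proof
    fix i j assume ij: "i < m" "j < m"
    have "(\<Sum>l<k. p i l * p j l) = (\<Sum>l<k. (transpose_mat B *\<^sub>v u i) $ l * (transpose_mat B *\<^sub>v u j) $ l) / (lam i * lam j)"
      unfolding p_def by (simp add: sum_divide_distrib del: index_mult_mat_vec)
    also have "\<dots> = (u i \<bullet> ((lam j)\<^sup>2 \<cdot>\<^sub>v u j)) / (lam i * lam j)"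
      unfolding scalar_prod_gram[OF B u[OF ij(1)] u[OF ij(2)]] G eig[OF ij(2)] ..
    also have "\<dots> = (if i = j then 1 else 0)"
      using lam[OF ij(1)] lam[OF ij(2)] orth[OF ij] scalar_prod_smult_right[of "u i" "u j"] u[OF ij(1)] u[OF ij(2)]
      by (simp add: power2_eq_square)
    finally show "(\<Sum>l<k. p i l * p j l) = (if i = j then 1 else 0)" .
  next
    fix i j assume i: "i < d" and j: "j < m"
    have "(\<Sum>l<k. Bf i l * p j l) = (B *\<^sub>v (transpose_mat B *\<^sub>v u j)) $ i / lam j"
      using i B mult_mat_vec_carrier[OF BT u[OF j]]
      by (simp add: p_def Bf_def scalar_prod_def[of _ "_ *\<^sub>v _"] lessThan_atLeast0 sum_divide_distrib)
    also have "B *\<^sub>v (transpose_mat B *\<^sub>v u j) = (lam j)\<^sup>2 \<cdot>\<^sub>v u j"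
      using assoc_mult_mat_vec[OF B BT u[OF j]] by (simp only: G eig[OF j])
    finally show "(\<Sum>l<k. Bf i l * p j l) = lam j * u j $ i"
      using i lam[OF j] u[OF j] by (simp add: power2_eq_square)
  next
    fix l j assume "l < k" "j < m"
    then show "(\<Sum>i<d. u j $ i * Bf i l) = lam j * p j l"
      using lam[of j] by (simp add: p_def BTu del: index_mult_mat_vec)
  qed (use lam A0 in auto)
  have lik: "lik H y (A *\<^sub>v Matrix.vec k z) = exp (- V z)" for z
  proof -
    have "(H *\<^sub>v (A *\<^sub>v Matrix.vec k z)) $ i = lin k (Bf i) z" if "i < d" for i
      using assoc_mult_mat_vec[OF H A(1), of "Matrix.vec k z"] mult_mat_vec_vec_eq_lin[OF B that, of z]
      by (simp add: B_def[symmetric] Bf_def[abs_def])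
    then show ?thesis
      by (simp add: lik_def vec_nrm_diff_sq[OF H y] V_def del: index_mult_mat_vec)
  qed
  have WW: "lik H y (A *\<^sub>v Matrix.vec k z) / (lik H y (A *\<^sub>v Matrix.vec k z) + A0) = W z" for z
    by (simp add: lik W_def)
  have b_eq: "b j = u j \<bullet> y / lam j" for j
    using y by (simp add: b_def scalar_prod_def lessThan_atLeast0)
  have ym: "(\<lambda>x. lik H y x) \<in> borel_measurable (borel_vec q)"
    by (rule measurable_lik[OF H]) (use y in auto)
  have "(\<integral>z. W z * (1 - W z) \<partial>std_gauss k) \<le> 4 * t / \<delta>\<^sup>2 * (\<integral>z. W z \<partial>std_gauss k) + single_error \<delta> t K m"
    unfolding single_error_def by (rule integral_W_le) (use m \<delta> t K b in \<open>auto simp: b_eq\<close>)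
  then show ?thesis
    using ym unfolding \<mu>'
    by (subst (1 2) integral_distr[OF meas])
       (auto simp only: WW intro!: borel_measurable_times borel_measurable_divide borel_measurable_diff
          borel_measurable_add borel_measurable_const)
qed

lemma lik_pos: "0 < lik H y x"
  by (simp add: lik_def)

lemma weight_eq_lik: "weight H n y x i = lik H y (x i) / (\<Sum>j=1..n. lik H y (x j))"
  by (simp add: weight_def lik_def)

lemma sum_lik_pos: "1 \<le> (n::nat) \<Longrightarrow> 0 < (\<Sum>j=1..n. lik H y (x j))"
  by (intro sum_pos) (auto intro: lik_pos)

lemma weight_bounds:
  assumes "i \<in> {1..n}"
  shows "0 \<le> weight H n y x i" "weight H n y x i \<le> 1"
proof -
  have "1 \<le> n" using assms by simp
  note pos = sum_lik_pos[OF this, of H y x]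
  have "lik H y (x i) \<le> (\<Sum>j=1..n. lik H y (x j))"
    using assms by (intro member_le_sum) (auto intro: less_imp_le lik_pos)
  then show "0 \<le> weight H n y x i" "weight H n y x i \<le> 1"
    using pos lik_pos[of H y "x i"] by (auto simp: weight_eq_lik divide_simps)
qed

lemma sum_weight: "1 \<le> n \<Longrightarrow> (\<Sum>i=1..n. weight H n y x i) = 1"
  using sum_lik_pos[of n H y x] by (simp add: weight_eq_lik sum_divide_distrib[symmetric])

text \<open>
  A smooth substitute for the maximum: since the weights sum to one,
  \<open>\<Sum>i. w i * (1 - w i)\<close> is an average of the numbers \<open>1 - w i\<close>, each of which is at least \<open>1 - max w\<close>.
\<close>

lemma one_minus_max_weight_le:
  assumes n: "1 \<le> n"
  shows "0 \<le> 1 - max_weight H n y x"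
    and "1 - max_weight H n y x \<le> (\<Sum>i=1..n. weight H n y x i * (1 - weight H n y x i))"
proof -
  have fin: "finite (weight H n y x ` {1..n})" "weight H n y x ` {1..n} \<noteq> {}" using n by auto
  have "max_weight H n y x \<in> weight H n y x ` {1..n}" unfolding max_weight_def by (rule Max_in[OF fin])
  then show "0 \<le> 1 - max_weight H n y x" using weight_bounds[of _ n H y x] by auto
  have "1 - max_weight H n y x = (\<Sum>i=1..n. weight H n y x i * (1 - max_weight H n y x))"
    unfolding sum_distrib_right[symmetric] sum_weight[OF n] by simp
  also have "\<dots> \<le> (\<Sum>i=1..n. weight H n y x i * (1 - weight H n y x i))"
  proof (intro sum_mono mult_left_mono)
    fix i assume i: "i \<in> {1..n}"
    show "1 - max_weight H n y x \<le> 1 - weight H n y x i"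
      unfolding max_weight_def using Max_ge[OF fin(1), of "weight H n y x i"] i by simp
    show "0 \<le> weight H n y x i" using weight_bounds(1)[OF i] .
  qed
  finally show "1 - max_weight H n y x \<le> (\<Sum>i=1..n. weight H n y x i * (1 - weight H n y x i))" .
qed

lemma single_error_nonneg:
  "0 < t \<Longrightarrow> 0 < K \<Longrightarrow> 0 \<le> single_error \<delta> t K m"
  unfolding single_error_def by (intro add_nonneg_nonneg mult_nonneg_nonneg divide_nonneg_nonneg) auto

text \<open>
  Each summand is integrated first over its own sample with all other samples held fixed, which is the
  situation of the bound for one sample. Adding up, the terms proportional to the weights contribute
  \<open>4 * t / \<delta>\<^sup>2\<close> in total, however large the sample.
\<close>

lemma nn_integral_sum_weight_le:
  fixes u :: "nat \<Rightarrow> real Matrix.vec" and lam :: "nat \<Rightarrow> real" and y :: "real Matrix.vec"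
  assumes L: "\<And>i. centered_normal q C (L i)" and n: "1 \<le> n" and H: "H \<in> carrier_mat d q"
    and u: "\<And>j. j < m \<Longrightarrow> u j \<in> carrier_vec d"
    and eig: "\<And>j. j < m \<Longrightarrow> (H * C * transpose_mat H) *\<^sub>v u j = (lam j)\<^sup>2 \<cdot>\<^sub>v u j"
    and orth: "\<And>i j. i < m \<Longrightarrow> j < m \<Longrightarrow> u i \<bullet> u j = (if i = j then 1 else 0)"
    and m: "0 < m" and \<delta>: "0 < \<delta>" "\<And>j. j < m \<Longrightarrow> \<delta> \<le> lam j"
    and t: "0 < t" "t \<le> 1" and K: "0 < K"
    and y: "y \<in> carrier_vec d" and b: "(\<Sum>j<m. (u j \<bullet> y / lam j)\<^sup>2) \<le> K * real m"
  shows "(\<integral>\<^sup>+x. ennreal (\<Sum>i=1..n. weight H n y x i * (1 - weight H n y x i)) \<partial>PiM {1..n} L) \<le>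
    ennreal (4 * t / \<delta>\<^sup>2 + real n * single_error \<delta> t K m)"
proof -
  define \<kappa> where "\<kappa> = 4 * t / \<delta>\<^sup>2"
  define err where "err = single_error \<delta> t K m"
  have \<kappa>: "0 \<le> \<kappa>" and err: "0 \<le> err" using t K by (auto simp: \<kappa>_def err_def single_error_nonneg)
  interpret P: product_prob_space L
    by (intro product_prob_space.intro product_sigma_finite.intro product_prob_space_axioms.intro
        prob_space_imp_sigma_finite centered_normal_prob_space(1)[OF L])
  have setsL [measurable_cong]: "sets (L i) = sets (borel_vec q)" for i by (rule centered_normal_prob_space(2)[OF L])
  have lik_m: "(\<lambda>x. lik H y x) \<in> borel_measurable (L i)" for i
    using measurable_lik[OF H, of "\<lambda>_. y" "borel_vec q" "\<lambda>x. x"] y by (simp add: measurable_cong_sets[OF setsL refl])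
  have likP [measurable]: "(\<lambda>x. lik H y (x j)) \<in> borel_measurable (PiM I L)" if "j \<in> I" for I j
    by (rule measurable_compose[OF measurable_component_singleton[OF that] lik_m])
  have wP: "(\<lambda>x. weight H n y x i) \<in> borel_measurable (PiM {1..n} L)" if "i \<in> {1..n}" for i
    unfolding weight_eq_lik using that by (intro borel_measurable_divide borel_measurable_sum likP)
  have single: "(\<integral>\<^sup>+x. ennreal (weight H n y x i * (1 - weight H n y x i)) \<partial>PiM {1..n} L) \<le>
      (\<integral>\<^sup>+x. ennreal (\<kappa> * weight H n y x i + err) \<partial>PiM {1..n} L)" if i: "i \<in> {1..n}" for i
  proof -
    let ?J = "{1..n} - {i}"
    have ins: "{1..n} = insert i ?J" using i by auto
    have meas: "(\<lambda>x. weight H n y x i) \<in> borel_measurable (PiM (insert i ?J) L)"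
      using wP[OF i] ins by simp
    have "(\<integral>\<^sup>+x. ennreal (weight H n y x i * (1 - weight H n y x i)) \<partial>PiM {1..n} L) =
        (\<integral>\<^sup>+x. (\<integral>\<^sup>+z. ennreal (weight H n y (x(i := z)) i * (1 - weight H n y (x(i := z)) i)) \<partial>L i) \<partial>PiM ?J L)"
      by (subst ins, rule P.product_nn_integral_insert) (use meas in auto)
    also have "\<dots> \<le> (\<integral>\<^sup>+x. (\<integral>\<^sup>+z. ennreal (\<kappa> * weight H n y (x(i := z)) i + err) \<partial>L i) \<partial>PiM ?J L)"
    proof (rule nn_integral_mono)
      fix x
      define A0 where "A0 = (\<Sum>j\<in>?J. lik H y (x j))"
      have A0: "0 \<le> A0" unfolding A0_def by (intro sum_nonneg less_imp_le lik_pos)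
      define w where "w z = lik H y z / (lik H y z + A0)" for z
      have w: "weight H n y (x(i := z)) i = w z" for z
      proof -
        have "(\<Sum>j=1..n. lik H y ((x(i := z)) j)) = lik H y z + (\<Sum>j\<in>?J. lik H y ((x(i := z)) j))"
          using i by (subst sum.remove[of _ i]) auto
        also have "(\<Sum>j\<in>?J. lik H y ((x(i := z)) j)) = A0"
          unfolding A0_def by (intro sum.cong) auto
        finally show ?thesis by (simp add: weight_eq_lik w_def)
      qed
      have wb: "0 \<le> w z" "w z \<le> 1" for z
        using A0 lik_pos[of H y z] by (auto simp: w_def divide_simps)
      have [measurable]: "w \<in> borel_measurable (L i)"
        unfolding w_def[abs_def] by (intro borel_measurable_divide borel_measurable_add borel_measurable_const lik_m)
      have Li: "prob_space (L i)" by (rule centered_normal_prob_space(1)[OF L])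
      have i1: "integrable (L i) w" "integrable (L i) (\<lambda>z. w z * (1 - w z))"
        by (rule finite_measure.integrable_const_bound[OF prob_space.finite_measure[OF Li], of _ 1]; use wb in \<open>auto simp: abs_mult intro!: mult_le_one\<close>)+
      have "(\<integral>\<^sup>+z. ennreal (w z * (1 - w z)) \<partial>L i) = ennreal (\<integral>z. w z * (1 - w z) \<partial>L i)"
        by (rule nn_integral_eq_integral[OF i1(2)]) (use wb in auto)
      also have "\<dots> \<le> ennreal (\<kappa> * (\<integral>z. w z \<partial>L i) + err)"
        unfolding w_def \<kappa>_def err_def
        by (rule ennreal_leI, rule single_sample_bound[OF L H u eig orth m \<delta> t K y b A0])
      also have "\<kappa> * (\<integral>z. w z \<partial>L i) + err = (\<integral>z. \<kappa> * w z + err \<partial>L i)"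
        using i1 by (simp add: prob_space.prob_space[OF Li])
      also have "ennreal \<dots> = (\<integral>\<^sup>+z. ennreal (\<kappa> * w z + err) \<partial>L i)"
        by (rule nn_integral_eq_integral[symmetric]) (use i1 wb \<kappa> err in auto)
      finally show "(\<integral>\<^sup>+z. ennreal (weight H n y (x(i := z)) i * (1 - weight H n y (x(i := z)) i)) \<partial>L i) \<le>
          (\<integral>\<^sup>+z. ennreal (\<kappa> * weight H n y (x(i := z)) i + err) \<partial>L i)" unfolding w .
    qed
    also have "\<dots> = (\<integral>\<^sup>+x. ennreal (\<kappa> * weight H n y x i + err) \<partial>PiM {1..n} L)"
      unfolding arg_cong[OF ins, of "\<lambda>I. PiM I L"]
      by (rule P.product_nn_integral_insert[symmetric]) (use meas in auto)
    finally show ?thesis .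
  qed
  have "(\<integral>\<^sup>+x. ennreal (\<Sum>i=1..n. weight H n y x i * (1 - weight H n y x i)) \<partial>PiM {1..n} L) =
      (\<integral>\<^sup>+x. (\<Sum>i=1..n. ennreal (weight H n y x i * (1 - weight H n y x i))) \<partial>PiM {1..n} L)"
    using weight_bounds by (intro nn_integral_cong sum_ennreal[symmetric]) auto
  also have "\<dots> = (\<Sum>i=1..n. \<integral>\<^sup>+x. ennreal (weight H n y x i * (1 - weight H n y x i)) \<partial>PiM {1..n} L)"
    using wP by (intro nn_integral_sum) auto
  also have "\<dots> \<le> (\<Sum>i=1..n. \<integral>\<^sup>+x. ennreal (\<kappa> * weight H n y x i + err) \<partial>PiM {1..n} L)"
    by (intro sum_mono single)
  also have "\<dots> = (\<integral>\<^sup>+x. (\<Sum>i=1..n. ennreal (\<kappa> * weight H n y x i + err)) \<partial>PiM {1..n} L)"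
    using wP by (intro nn_integral_sum[symmetric]) auto
  also have "\<dots> = (\<integral>\<^sup>+x. ennreal (\<kappa> + real n * err) \<partial>PiM {1..n} L)"
  proof (rule nn_integral_cong)
    fix x
    have "(\<Sum>i=1..n. ennreal (\<kappa> * weight H n y x i + err)) = ennreal (\<Sum>i=1..n. \<kappa> * weight H n y x i + err)"
      using weight_bounds \<kappa> err by (intro sum_ennreal) auto
    also have "(\<Sum>i=1..n. \<kappa> * weight H n y x i + err) = \<kappa> + real n * err"
      by (simp only: sum.distrib sum_distrib_left[symmetric] sum_weight[OF n]) simp
    finally show "(\<Sum>i=1..n. ennreal (\<kappa> * weight H n y x i + err)) = ennreal (\<kappa> + real n * err)" .
  qed
  also have "\<dots> = ennreal (\<kappa> + real n * err)"
    using prob_space.emeasure_space_1[OF prob_space_PiM[OF centered_normal_prob_space(1)[OF L]], of "{1..n}"]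
    by simp
  finally show ?thesis unfolding \<kappa>_def err_def .
qed

lemma (in prob_space) joint_distr_eq_pair_measure:
  assumes U: "U \<in> measurable M N1" and V: "V \<in> measurable M N2"
    and indep: "indep_set \<A> \<B>"
    and U\<A>: "\<And>A. A \<in> sets N1 \<Longrightarrow> U -` A \<inter> space M \<in> \<A>"
    and V\<B>: "\<And>B. B \<in> sets N2 \<Longrightarrow> V -` B \<inter> space M \<in> \<B>"
  shows "distr M (N1 \<Otimes>\<^sub>M N2) (\<lambda>\<omega>. (U \<omega>, V \<omega>)) = distr M N1 U \<Otimes>\<^sub>M distr M N2 V"
proof (rule pair_measure_eqI[symmetric])
  interpret D1: prob_space "distr M N1 U" by (rule prob_space_distr[OF U])
  interpret D2: prob_space "distr M N2 V" by (rule prob_space_distr[OF V])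
  show "sigma_finite_measure (distr M N1 U)" "sigma_finite_measure (distr M N2 V)" by unfold_locales
  note UV = measurable_Pair[OF U V]
  fix A B assume "A \<in> sets (distr M N1 U)" "B \<in> sets (distr M N2 V)"
  then have A: "A \<in> sets N1" and B: "B \<in> sets N2" by auto
  have "emeasure (distr M (N1 \<Otimes>\<^sub>M N2) (\<lambda>\<omega>. (U \<omega>, V \<omega>))) (A \<times> B) =
      emeasure M ((U -` A \<inter> space M) \<inter> (V -` B \<inter> space M))"
    using A B by (subst emeasure_distr[OF UV]) (auto intro!: arg_cong[where f = "emeasure M"])
  also have "\<dots> = ennreal (prob (U -` A \<inter> space M) * prob (V -` B \<inter> space M))"
    unfolding emeasure_eq_measure indep_setD[OF indep U\<A>[OF A] V\<B>[OF B]] ..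
  also have "\<dots> = emeasure (distr M N1 U) A * emeasure (distr M N2 V) B"
    using A B by (simp add: emeasure_distr[OF U] emeasure_distr[OF V] emeasure_eq_measure ennreal_mult)
  finally show "emeasure (distr M N1 U) A * emeasure (distr M N2 V) B =
    emeasure (distr M (N1 \<Otimes>\<^sub>M N2) (\<lambda>\<omega>. (U \<omega>, V \<omega>))) (A \<times> B)" by simp
qed simp

text \<open>
  The bound for fixed \<open>y\<close> needs \<open>\<Sum>j. (b j)\<^sup>2 \<le> K * m\<close>. Since each \<open>b j\<close> has second moment at most
  \<open>2 + 2 / \<delta>\<^sup>2\<close>, Markov's inequality bounds the probability of the exceptional observations by the first
  term; on the other observations Markov's inequality is applied to \<open>\<Sum>i. w i * (1 - w i)\<close>.
\<close>

lemma gaussian_weighting_tail_bound: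
  fixes lam :: "nat \<Rightarrow> real"
  assumes model: "gaussian_weighting_model M d q r n H C X \<epsilon> S"
    and spectrum: "nonzero_eigenvalues (H * C * transpose_mat H) m (\<lambda>j. (lam j)\<^sup>2)"
    and m: "0 < m" and \<delta>: "0 < \<delta>" "\<And>j. 1 \<le> j \<Longrightarrow> j \<le> m \<Longrightarrow> \<delta> \<le> lam j"
    and t: "0 < t" "t \<le> 1" and K: "0 < K" and e: "0 < e"
  shows "measure M {\<omega> \<in> space M. \<bar>max_weight H n (H *\<^sub>v X \<omega> + \<epsilon> \<omega>) (\<lambda>i. S i \<omega>) - 1\<bar> > e} \<le>
    (2 + 2 / \<delta>\<^sup>2) / K + (4 * t / \<delta>\<^sup>2 + real n * single_error \<delta> t K m) / e"
proof -
  interpret gaussian_weighting_model M d q r n H C X \<epsilon> S by (rule model)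
  note H = H_carrier
  have mX [measurable]: "X \<in> measurable M (borel_vec q)" and m\<epsilon> [measurable]: "\<epsilon> \<in> measurable M (borel_vec d)"
    using indep_X_\<epsilon> by (auto dest: indep_var_rv1 indep_var_rv2)
  have mS [measurable]: "S i \<in> measurable M (borel_vec q)" if "i \<in> {1..n}" for i
    using indep_S that by (auto simp: indep_vars_def)
  define Y where "Y \<omega> = H *\<^sub>v X \<omega> + \<epsilon> \<omega>" for \<omega>
  have mY [measurable]: "Y \<in> measurable M (borel_vec d)"
    unfolding Y_def[abs_def] by (rule measurable_add_vec[OF measurable_mult_mat_vec[OF mX H] m\<epsilon>])
  \<comment> \<open>Any factorisation of the covariance shows that \<open>C\<close>, and hence \<open>H C H\<^sup>T\<close>, is symmetric.\<close>
  obtain k A where A: "A \<in> carrier_mat q k" "C = A * transpose_mat A"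
    using centered_normalE[OF law_X] by metis
  have C: "C \<in> carrier_mat q q" using A by auto
  have symC: "transpose_mat C = C" unfolding A(2) using A(1) by (simp add: transpose_mult[of _ q k _ q])
  have HT: "transpose_mat H \<in> carrier_mat q d" using H by simp
  have G: "H * C * transpose_mat H \<in> carrier_mat d d" using H C by simp
  have symG: "transpose_mat (H * C * transpose_mat H) = H * C * transpose_mat H"
    using transpose_mult[of "H * C" d q "transpose_mat H" d] transpose_mult[OF H C] symC assoc_mult_mat[OF H C HT]
      H C HT by simp
  define l where "l j = lam (Suc j)" for j
  have l: "\<delta> \<le> l j" if "j < m" for j using \<delta>(2) that by (simp add: l_def)
  obtain u where u: "\<And>j. j < m \<Longrightarrow> u j \<in> carrier_vec d"
    and eig: "\<And>j. j < m \<Longrightarrow> (H * C * transpose_mat H) *\<^sub>v u j = (l j)\<^sup>2 \<cdot>\<^sub>v u j"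
    and orth: "\<And>i j. i < m \<Longrightarrow> j < m \<Longrightarrow> u i \<bullet> u j = (if i = j then 1 else 0)"
    using orthonormal_eigenvectors_of_nonzero_spectrum[OF G symG spectrum] unfolding l_def by blast
  define N where "N y = (\<Sum>j<m. (u j \<bullet> y / l j)\<^sup>2)" for y
  have mN: "N \<in> borel_measurable (borel_vec d)"
    unfolding N_def[abs_def]
    by (intro borel_measurable_sum borel_measurable_power borel_measurable_divide measurable_scalar_prod[where k = d] borel_measurable_const) simp
  have mNY [measurable]: "(\<lambda>\<omega>. N (Y \<omega>)) \<in> borel_measurable M" by (rule measurable_compose[OF mY mN])
  have EN: "(\<integral>\<^sup>+\<omega>. ennreal (N (Y \<omega>)) \<partial>M) \<le> ennreal ((2 + 2 / \<delta>\<^sup>2) * real m)"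
  proof -
    have one: "(\<integral>\<^sup>+\<omega>. ennreal ((u j \<bullet> Y \<omega> / l j)\<^sup>2) \<partial>M) \<le> ennreal (2 + 2 / \<delta>\<^sup>2)" if j: "j < m" for j
    proof -
      have lj: "0 < l j" using l[OF j] \<delta>(1) by linarith
      define c where "c = transpose_mat H *\<^sub>v u j"
      have c: "c \<in> carrier_vec q" using HT u[OF j] by (simp add: c_def)
      have cX: "u j \<bullet> (H *\<^sub>v X \<omega>) = c \<bullet> X \<omega>" if "\<omega> \<in> space M" for \<omega>
        using transpose_vec_mult_scalar[OF H _ u[OF j], of "X \<omega>"] measurable_space[OF mX that] by (simp add: c_def)
      have "c \<bullet> (C *\<^sub>v c) = u j \<bullet> (H *\<^sub>v (C *\<^sub>v c))"
        unfolding c_def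
        by (rule transpose_vec_mult_scalar[OF H _ u[OF j]]) (use C c in \<open>simp add: c_def[symmetric]\<close>)
      also have "H *\<^sub>v (C *\<^sub>v c) = (H * C * transpose_mat H) *\<^sub>v u j"
        using assoc_mult_mat_vec[OF H C c] assoc_mult_mat_vec[of "H * C" d q "transpose_mat H" d "u j"] H C HT u[OF j]
        by (simp add: c_def)
      also have "u j \<bullet> \<dots> = (l j)\<^sup>2" unfolding eig[OF j] using u[OF j] orth[OF j j] by simp
      finally have cCc: "c \<bullet> (C *\<^sub>v c) = (l j)\<^sup>2" .
      have EX: "(\<integral>\<^sup>+\<omega>. ennreal ((c \<bullet> X \<omega>)\<^sup>2) \<partial>M) = ennreal ((l j)\<^sup>2)"
        using centered_normal_second_moment[OF law_X c] unfolding cCc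
        by (subst (asm) nn_integral_distr[OF mX])
           (auto intro!: measurable_compose[OF measurable_scalar_prod[OF measurable_ident]])
      have E\<epsilon>: "(\<integral>\<^sup>+\<omega>. ennreal ((u j \<bullet> \<epsilon> \<omega>)\<^sup>2) \<partial>M) = ennreal 1"
        using centered_normal_second_moment[OF law_\<epsilon> u[OF j]] u[OF j] orth[OF j j]
        by (subst (asm) nn_integral_distr[OF m\<epsilon>])
           (auto intro!: measurable_compose[OF measurable_scalar_prod[OF measurable_ident]])
      have "(\<integral>\<^sup>+\<omega>. ennreal ((u j \<bullet> Y \<omega> / l j)\<^sup>2) \<partial>M) \<le>
          (\<integral>\<^sup>+\<omega>. ennreal (2 / (l j)\<^sup>2) * (ennreal ((c \<bullet> X \<omega>)\<^sup>2) + ennreal ((u j \<bullet> \<epsilon> \<omega>)\<^sup>2)) \<partial>M)"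
      proof (rule nn_integral_mono)
        fix \<omega> assume \<omega>: "\<omega> \<in> space M"
        have \<epsilon>c: "\<epsilon> \<omega> \<in> carrier_vec d" and Xc: "X \<omega> \<in> carrier_vec q"
          using measurable_space[OF m\<epsilon> \<omega>] measurable_space[OF mX \<omega>] by simp_all
        have "u j \<bullet> Y \<omega> = c \<bullet> X \<omega> + u j \<bullet> \<epsilon> \<omega>"
          unfolding Y_def cX[OF \<omega>, symmetric]
          using scalar_prod_add_distrib[OF u[OF j] mult_mat_vec_carrier[OF H Xc] \<epsilon>c] by simp
        then have "(u j \<bullet> Y \<omega> / l j)\<^sup>2 = (c \<bullet> X \<omega> + u j \<bullet> \<epsilon> \<omega>)\<^sup>2 / (l j)\<^sup>2"
          by (simp add: power_divide)
        also have "\<dots> \<le> (2 * ((c \<bullet> X \<omega>)\<^sup>2 + (u j \<bullet> \<epsilon> \<omega>)\<^sup>2)) / (l j)\<^sup>2"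
        proof (rule divide_right_mono)
          show "(c \<bullet> X \<omega> + u j \<bullet> \<epsilon> \<omega>)\<^sup>2 \<le> 2 * ((c \<bullet> X \<omega>)\<^sup>2 + (u j \<bullet> \<epsilon> \<omega>)\<^sup>2)"
            using sum_squares_bound[of "c \<bullet> X \<omega>" "u j \<bullet> \<epsilon> \<omega>"] by (simp add: power2_sum)
        qed simp
        finally have "ennreal ((u j \<bullet> Y \<omega> / l j)\<^sup>2) \<le> ennreal (2 / (l j)\<^sup>2 * ((c \<bullet> X \<omega>)\<^sup>2 + (u j \<bullet> \<epsilon> \<omega>)\<^sup>2))"
          by (intro ennreal_leI) simp
        then show "ennreal ((u j \<bullet> Y \<omega> / l j)\<^sup>2) \<le> ennreal (2 / (l j)\<^sup>2) * (ennreal ((c \<bullet> X \<omega>)\<^sup>2) + ennreal ((u j \<bullet> \<epsilon> \<omega>)\<^sup>2))"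
          by (subst ennreal_plus[symmetric], simp, simp, subst ennreal_mult[symmetric], simp, simp)
      qed
      also have "\<dots> = ennreal (2 / (l j)\<^sup>2) * (ennreal ((l j)\<^sup>2) + ennreal 1)"
      proof -
        have [measurable]: "(\<lambda>\<omega>. c \<bullet> X \<omega>) \<in> borel_measurable M" "(\<lambda>\<omega>. u j \<bullet> \<epsilon> \<omega>) \<in> borel_measurable M"
          by (rule measurable_scalar_prod[OF mX], rule measurable_scalar_prod[OF m\<epsilon>])
        show ?thesis unfolding EX[symmetric] E\<epsilon>[symmetric]
          by (subst nn_integral_cmult, measurable, subst nn_integral_add, measurable)
      qed
      also have "\<dots> = ennreal (2 / (l j)\<^sup>2 * ((l j)\<^sup>2 + 1))"
        by (subst ennreal_plus[symmetric], simp, simp, subst ennreal_mult[symmetric]) auto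
      also have "\<dots> \<le> ennreal (2 + 2 / \<delta>\<^sup>2)"
      proof (rule ennreal_leI)
        have "2 / (l j)\<^sup>2 * ((l j)\<^sup>2 + 1) = 2 + 2 / (l j)\<^sup>2" using lj by (simp add: field_simps)
        also have "\<dots> \<le> 2 + 2 / \<delta>\<^sup>2"
          using \<delta>(1) l[OF j] by (intro add_left_mono divide_left_mono power_mono) (auto simp: lj)
        finally show "2 / (l j)\<^sup>2 * ((l j)\<^sup>2 + 1) \<le> 2 + 2 / \<delta>\<^sup>2" .
      qed
      finally show ?thesis .
    qed
    have "(\<integral>\<^sup>+\<omega>. ennreal (N (Y \<omega>)) \<partial>M) = (\<integral>\<^sup>+\<omega>. (\<Sum>j<m. ennreal ((u j \<bullet> Y \<omega> / l j)\<^sup>2)) \<partial>M)"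
      unfolding N_def by (intro nn_integral_cong sum_ennreal[symmetric]) auto
    also have "\<dots> = (\<Sum>j<m. \<integral>\<^sup>+\<omega>. ennreal ((u j \<bullet> Y \<omega> / l j)\<^sup>2) \<partial>M)"
      using measurable_scalar_prod[OF mY] by (intro nn_integral_sum) auto
    also have "\<dots> \<le> (\<Sum>j<m. ennreal (2 + 2 / \<delta>\<^sup>2))" by (intro sum_mono one) auto
    also have "\<dots> = ennreal ((2 + 2 / \<delta>\<^sup>2) * real m)"
      by (simp add: ennreal_mult ennreal_of_nat_eq_real_of_nat mult.commute)
    finally show ?thesis .
  qed
  \<comment> \<open>Outside \<open>{1..n}\<close> the law of \<open>S 1\<close> is used, so that all factors are centred normal laws.\<close>
  define L where "L i = distr M (borel_vec q) (if i \<in> {1..n} then S i else S 1)" for i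
  have L: "centered_normal q C (L i)" for i using law_S n_pos by (simp add: L_def)
  define Sv where "Sv \<omega> = (\<lambda>i\<in>{1..n}. S i \<omega>)" for \<omega>
  have mSv: "Sv \<in> measurable M (PiM {1..n} (\<lambda>_. borel_vec q))"
    unfolding Sv_def[abs_def] by (rule measurable_restrict) (rule mS)
  have distrS: "distr M (PiM {1..n} (\<lambda>_. borel_vec q)) Sv = PiM {1..n} L"
  proof -
    have "distr M (PiM {1..n} (\<lambda>_. borel_vec q)) Sv = PiM {1..n} (\<lambda>i. distr M (borel_vec q) (S i))"
      using indep_S n_pos unfolding Sv_def[abs_def] by (subst (asm) indep_vars_iff_distr_eq_PiM') (auto intro: mS)
    also have "\<dots> = PiM {1..n} L" by (rule PiM_cong) (auto simp: L_def)
    finally show ?thesis .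
  qed
  have joint: "distr M (PiM {1..n} (\<lambda>_. borel_vec q) \<Otimes>\<^sub>M borel_vec d) (\<lambda>\<omega>. (Sv \<omega>, Y \<omega>)) =
      PiM {1..n} L \<Otimes>\<^sub>M distr M (borel_vec d) Y"
    unfolding distrS[symmetric]
  proof (rule joint_distr_eq_pair_measure[OF mSv mY indep_S_X_\<epsilon>])
    fix B assume "B \<in> sets (PiM {1..n} (\<lambda>_. borel_vec q))"
    then show "Sv -` B \<inter> space M \<in> sets (vimage_algebra (space M) (\<lambda>\<omega>. \<lambda>i\<in>{1..n}. S i \<omega>) (PiM {1..n} (\<lambda>_. borel_vec q)))"
      unfolding Sv_def[abs_def] by (rule in_vimage_algebra)
  next
    fix B assume B: "B \<in> sets (borel_vec d)"
    let ?g = "\<lambda>(x, e). H *\<^sub>v x + e"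
    have g: "?g \<in> measurable (borel_vec q \<Otimes>\<^sub>M borel_vec d) (borel_vec d)"
      unfolding split_beta
      by (rule measurable_add_vec[OF measurable_mult_mat_vec[OF measurable_fst H] measurable_snd])
    have "Y -` B \<inter> space M = (\<lambda>\<omega>. (X \<omega>, \<epsilon> \<omega>)) -` (?g -` B \<inter> space (borel_vec q \<Otimes>\<^sub>M borel_vec d)) \<inter> space M"
      using measurable_space[OF mX] measurable_space[OF m\<epsilon>] by (auto simp: Y_def space_pair_measure)
    then show "Y -` B \<inter> space M \<in> sets (vimage_algebra (space M) (\<lambda>\<omega>. (X \<omega>, \<epsilon> \<omega>)) (borel_vec q \<Otimes>\<^sub>M borel_vec d))"
      using in_vimage_algebra[OF measurable_sets[OF g B]] by simp
  qed
  define D where "D = distr M (borel_vec d) Y"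
  \<comment> \<open>The exceptional observations are cut off, which makes the bound on the inner integral hold for every \<open>y\<close>.\<close>
  define F where "F s y = indicator {y. N y \<le> K * real m} y * (\<Sum>i=1..n. weight H n y s i * (1 - weight H n y s i))" for s y
  have setsP: "sets (PiM {1..n} L) = sets (PiM {1..n} (\<lambda>_. borel_vec q))"
    by (rule sets_PiM_cong) (auto simp: L_def)
  have mF: "(\<lambda>(s, y). F s y) \<in> borel_measurable (PiM {1..n} (\<lambda>_. borel_vec q) \<Otimes>\<^sub>M borel_vec d)"
  proof -
    have N': "(\<lambda>x. N (snd x)) \<in> borel_measurable (PiM {1..n} (\<lambda>_. borel_vec q) \<Otimes>\<^sub>M borel_vec d)"
      by (rule measurable_compose[OF measurable_snd mN])
    have l': "(\<lambda>x. lik H (snd x) (fst x i)) \<in> borel_measurable (PiM {1..n} (\<lambda>_. borel_vec q) \<Otimes>\<^sub>M borel_vec d)"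
      if "i \<in> {1..n}" for i
      by (rule measurable_lik[OF H measurable_snd measurable_compose[OF measurable_fst measurable_component_singleton[OF that]]])
    have ind: "(\<lambda>x. indicator {y. N y \<le> K * real m} (snd x) :: real) \<in> borel_measurable (PiM {1..n} (\<lambda>_. borel_vec q) \<Otimes>\<^sub>M borel_vec d)"
      unfolding indicator_def using N' by (auto intro!: measurable_If)
    show ?thesis unfolding F_def split_beta weight_eq_lik
      by (intro borel_measurable_times ind borel_measurable_sum borel_measurable_diff borel_measurable_divide borel_measurable_const l')
  qed
  have F0: "0 \<le> F s y" for s y
    unfolding F_def using weight_bounds by (auto intro!: mult_nonneg_nonneg sum_nonneg)
  let ?\<beta> = "4 * t / \<delta>\<^sup>2 + real n * single_error \<delta> t K m"
  have EF: "(\<integral>\<^sup>+\<omega>. ennreal (F (Sv \<omega>) (Y \<omega>)) \<partial>M) \<le> ennreal ?\<beta>"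
  proof -
    interpret D: prob_space D unfolding D_def by (rule prob_space_distr[OF mY])
    interpret P: prob_space "PiM {1..n} L" by (rule prob_space_PiM) (rule centered_normal_prob_space(1)[OF L])
    interpret PD: pair_sigma_finite "PiM {1..n} L" D ..
    have mF': "(\<lambda>(s, y). ennreal (F s y)) \<in> borel_measurable (PiM {1..n} L \<Otimes>\<^sub>M D)"
      using mF by (subst measurable_cong_sets[OF sets_pair_measure_cong[OF setsP] refl, of _ "borel_vec d"]) (auto simp: D_def split_beta)
    have "(\<integral>\<^sup>+\<omega>. ennreal (F (Sv \<omega>) (Y \<omega>)) \<partial>M) =
        (\<integral>\<^sup>+x. (\<lambda>(s, y). ennreal (F s y)) x \<partial>distr M (PiM {1..n} (\<lambda>_. borel_vec q) \<Otimes>\<^sub>M borel_vec d) (\<lambda>\<omega>. (Sv \<omega>, Y \<omega>)))"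
      using mF by (subst nn_integral_distr[OF measurable_Pair[OF mSv mY]]) (auto simp: split_beta)
    also have "\<dots> = (\<integral>\<^sup>+y. (\<integral>\<^sup>+s. ennreal (F s y) \<partial>PiM {1..n} L) \<partial>D)"
      unfolding joint D_def[symmetric] using PD.nn_integral_snd[OF mF'] by simp
    also have "\<dots> \<le> (\<integral>\<^sup>+y. ennreal ?\<beta> \<partial>D)"
    proof (rule nn_integral_mono)
      fix y assume "y \<in> space D"
      then have y: "y \<in> carrier_vec d" by (simp add: D_def)
      show "(\<integral>\<^sup>+s. ennreal (F s y) \<partial>PiM {1..n} L) \<le> ennreal ?\<beta>"
      proof (cases "N y \<le> K * real m")
        case True
        then have "F s y = (\<Sum>i=1..n. weight H n y s i * (1 - weight H n y s i))" for s
          by (simp add: F_def)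
        then show ?thesis
          using nn_integral_sum_weight_le[OF L n_pos H u eig orth m \<delta>(1) l t K y] True
          by (simp add: N_def)
      qed (simp add: F_def)
    qed
    also have "\<dots> = ennreal ?\<beta>" by (simp add: D.emeasure_space_1)
    finally show ?thesis .
  qed
  have \<beta>0: "0 \<le> ?\<beta>" using t K single_error_nonneg[OF t(1) K] by auto
  have mFM [measurable]: "(\<lambda>\<omega>. F (Sv \<omega>) (Y \<omega>)) \<in> borel_measurable M"
    using measurable_compose[OF measurable_Pair[OF mSv mY] mF] by simp
  let ?E1 = "{\<omega> \<in> space M. K * real m \<le> N (Y \<omega>)}" and ?E2 = "{\<omega> \<in> space M. e \<le> F (Sv \<omega>) (Y \<omega>)}"
  have Km: "0 < K * real m" using K m by simp
  have int: "integrable M f \<and> integral\<^sup>L M f \<le> c"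
    if "f \<in> borel_measurable M" "\<And>\<omega>. 0 \<le> f \<omega>" "(\<integral>\<^sup>+\<omega>. ennreal (f \<omega>) \<partial>M) \<le> ennreal c" "0 \<le> c" for f :: "'a \<Rightarrow> real" and c
  proof
    show i: "integrable M f"
      using that le_less_trans[OF that(3) ennreal_less_top] by (intro integrableI_nonneg) auto
    show "integral\<^sup>L M f \<le> c"
      using that nn_integral_eq_integral[OF i] by (simp add: ennreal_le_iff)
  qed
  have N0: "0 \<le> N y" for y unfolding N_def by (intro sum_nonneg) auto
  have "prob ?E1 \<le> (\<integral>\<omega>. N (Y \<omega>) \<partial>M) / (K * real m)"
    using int[OF mNY N0 EN] N0 Km \<delta>(1) by (intro integral_Markov_inequality_measure[where A = "{}"]) auto
  also have "\<dots> \<le> ((2 + 2 / \<delta>\<^sup>2) * real m) / (K * real m)"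
    using int[OF mNY N0 EN] Km by (intro divide_right_mono) auto
  also have "\<dots> = (2 + 2 / \<delta>\<^sup>2) / K" using m by simp
  finally have 1: "prob ?E1 \<le> (2 + 2 / \<delta>\<^sup>2) / K" .
  have "prob ?E2 \<le> (\<integral>\<omega>. F (Sv \<omega>) (Y \<omega>) \<partial>M) / e"
    using int[OF mFM F0 EF \<beta>0] F0 e by (intro integral_Markov_inequality_measure[where A = "{}"]) auto
  also have "\<dots> \<le> ?\<beta> / e"
    using int[OF mFM F0 EF \<beta>0] e by (intro divide_right_mono) auto
  finally have 2: "prob ?E2 \<le> ?\<beta> / e" .
  have "measure M {\<omega> \<in> space M. \<bar>max_weight H n (H *\<^sub>v X \<omega> + \<epsilon> \<omega>) (\<lambda>i. S i \<omega>) - 1\<bar> > e} \<le> prob (?E1 \<union> ?E2)"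
  proof (rule finite_measure_mono)
    show "{\<omega> \<in> space M. \<bar>max_weight H n (H *\<^sub>v X \<omega> + \<epsilon> \<omega>) (\<lambda>i. S i \<omega>) - 1\<bar> > e} \<subseteq> ?E1 \<union> ?E2"
    proof
      fix \<omega> assume "\<omega> \<in> {\<omega> \<in> space M. \<bar>max_weight H n (H *\<^sub>v X \<omega> + \<epsilon> \<omega>) (\<lambda>i. S i \<omega>) - 1\<bar> > e}"
      then have \<omega>: "\<omega> \<in> space M" and gt: "\<bar>max_weight H n (Y \<omega>) (\<lambda>i. S i \<omega>) - 1\<bar> > e"
        by (auto simp: Y_def)
      have wSv: "weight H n (Y \<omega>) (Sv \<omega>) i = weight H n (Y \<omega>) (\<lambda>i. S i \<omega>) i" if "i \<in> {1..n}" for i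
        using that by (simp add: weight_eq_lik Sv_def)
      have "e < 1 - max_weight H n (Y \<omega>) (\<lambda>i. S i \<omega>)"
        using gt one_minus_max_weight_le(1)[OF n_pos, of H "Y \<omega>" "\<lambda>i. S i \<omega>"] by linarith
      also have "\<dots> \<le> (\<Sum>i=1..n. weight H n (Y \<omega>) (\<lambda>i. S i \<omega>) i * (1 - weight H n (Y \<omega>) (\<lambda>i. S i \<omega>) i))"
        by (rule one_minus_max_weight_le(2)[OF n_pos])
      also have "\<dots> = (\<Sum>i=1..n. weight H n (Y \<omega>) (Sv \<omega>) i * (1 - weight H n (Y \<omega>) (Sv \<omega>) i))"
        by (intro sum.cong) (auto simp: wSv)
      finally show "\<omega> \<in> ?E1 \<union> ?E2"
        using \<omega> by (cases "N (Y \<omega>) \<le> K * real m") (auto simp: F_def)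
    qed
    show "?E1 \<union> ?E2 \<in> events" by measurable
  qed
  also have "\<dots> \<le> prob ?E1 + prob ?E2" by (rule measure_Un_le) measurable
  also have "\<dots> \<le> (2 + 2 / \<delta>\<^sup>2) / K + ?\<beta> / e" by (rule add_mono[OF 1 2])
  finally show ?thesis .
qed

section \<open>The limit\<close>

text \<open>
  The sample size is subexponential in the dimension, so it is absorbed by every exponentially small
  error.
\<close>

lemma mult_exp_neg_tendsto_0:
  fixes n :: "nat \<Rightarrow> nat"
  assumes n: "\<And>m. 1 \<le> m \<Longrightarrow> 1 \<le> n m"
    and rate: "(\<lambda>m. ln (real (n m)) / real m) \<longlonglongrightarrow> 0" and c: "0 < c"
  shows "(\<lambda>m. real (n m) * exp (- (c * real m))) \<longlonglongrightarrow> 0"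
proof (rule tendsto_sandwich[OF _ _ tendsto_const])
  show "\<forall>\<^sub>F m in sequentially. 0 \<le> real (n m) * exp (- (c * real m))" by simp
  have "\<forall>\<^sub>F m in sequentially. ln (real (n m)) / real m < c / 2"
    using rate c by (intro order_tendstoD) auto
  then show "\<forall>\<^sub>F m in sequentially. real (n m) * exp (- (c * real m)) \<le> exp (- (c / 2 * real m))"
    using eventually_ge_at_top[of 1]
  proof eventually_elim
    case (elim m)
    have "real (n m) > 0" using n[OF elim(2)] by simp
    then have "real (n m) * exp (- (c * real m)) = exp (ln (real (n m)) - c * real m)"
      by (simp add: exp_diff exp_minus divide_inverse)
    also have "\<dots> \<le> exp (- (c / 2 * real m))"
      using elim by (simp add: field_simps)
    finally show ?case .
  qed
  show "(\<lambda>m. exp (- (c / 2 * real m))) \<longlonglongrightarrow> 0"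
    using c by real_asymp
qed

lemma mult_single_error_tendsto_0:
  fixes n :: "nat \<Rightarrow> nat"
  assumes n: "\<And>m. 1 \<le> m \<Longrightarrow> 1 \<le> n m"
    and rate: "(\<lambda>m. ln (real (n m)) / real m) \<longlonglongrightarrow> 0" and t: "0 < t" and K: "0 < K"
  shows "(\<lambda>m. real (n m) * single_error \<delta> t K m) \<longlonglongrightarrow> 0"
proof -
  note lim = mult_exp_neg_tendsto_0[OF n rate]
  have 1: "(\<lambda>m. real (n m) * exp (- (1 / 32 * real m))) \<longlonglongrightarrow> 0"
    and 2: "(\<lambda>m. real (n m) * exp (- (t\<^sup>2 / 8 * real m))) \<longlonglongrightarrow> 0"
    and 3: "(\<lambda>m. real (n m) * exp (- (t\<^sup>2 / (2 * K) * real m))) \<longlonglongrightarrow> 0"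
    by (rule lim; use t K in simp)+
  have 4: "(\<lambda>m. K / (t * real m)) \<longlonglongrightarrow> 0" using t K by real_asymp
  have "(\<lambda>m. real (n m) * exp (- (1 / 32 * real m)) + 2 / \<delta>\<^sup>2 * (real (n m) * exp (- (t\<^sup>2 / 8 * real m)) +
      K / (t * real m) * (real (n m) * exp (- (t\<^sup>2 / (2 * K) * real m))))) \<longlonglongrightarrow> 0 + 2 / \<delta>\<^sup>2 * (0 + 0 * 0)"
    by (intro tendsto_intros 1 2 3 4)
  then show ?thesis by (simp add: single_error_def algebra_simps)
qed

theorem proposition3p2:
  fixes M :: "nat \<Rightarrow> 'a measure"
    and d q n :: "nat \<Rightarrow> nat"
    and H C :: "nat \<Rightarrow> real mat"
    and X \<epsilon> :: "nat \<Rightarrow> 'a \<Rightarrow> real Matrix.vec"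
    and S :: "nat \<Rightarrow> nat \<Rightarrow> 'a \<Rightarrow> real Matrix.vec"
    and lam :: "nat \<Rightarrow> nat \<Rightarrow> real"
    and \<delta> \<sigma> :: real
  assumes model: "\<And>d'. 1 \<le> d' \<Longrightarrow>
      gaussian_weighting_model (M d') (d d') (q d') d' (n d') (H d') (C d') (X d') (\<epsilon> d') (S d')"
    and lam_pos: "\<And>d' j. 1 \<le> j \<Longrightarrow> j \<le> d' \<Longrightarrow> 0 < lam d' j"
    and spectrum: "\<And>d'. 1 \<le> d' \<Longrightarrow>
      nonzero_eigenvalues (H d' * C d' * transpose_mat (H d')) d' (\<lambda>j. (lam d' j)\<^sup>2)"
    and n_lim: "filterlim n at_top sequentially"
    and \<delta>_pos: "0 < \<delta>"
    and A1: "\<And>d' j. 1 \<le> j \<Longrightarrow> j \<le> d' \<Longrightarrow> lam d' j \<le> 1 / \<delta> \<and> \<delta> < lam d' j"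
    and \<sigma>_pos: "0 < \<sigma>\<^sup>2"
    and A2: "(\<lambda>d'. 2 / real d' * (\<Sum>j=1..d'. 3 * lam d' j ^ 4 + 2 * (lam d' j)\<^sup>2)) \<longlonglongrightarrow> \<sigma>\<^sup>2"
    and growth: "(\<lambda>d'. ln (real (n d')) * ln (real d') / real d') \<longlonglongrightarrow> 0"
  shows "tends_to_in_probability M
      (\<lambda>d' \<omega>. max_weight (H d') (n d') (H d' *\<^sub>v X d' \<omega> + \<epsilon> d' \<omega>) (\<lambda>i. S d' i \<omega>)) 1"
  unfolding tends_to_in_probability_def
proof (intro allI impI)
  fix e :: real assume e: "0 < e"
  have n1: "1 \<le> n m" if "1 \<le> m" for m
    using model[OF that] by (simp add: gaussian_weighting_model_def gaussian_weighting_model_axioms_def)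
  have rate: "(\<lambda>m. ln (real (n m)) / real m) \<longlonglongrightarrow> 0"
  proof (rule tendsto_sandwich[OF _ _ tendsto_const growth])
    show "\<forall>\<^sub>F m in sequentially. 0 \<le> ln (real (n m)) / real m"
      using eventually_ge_at_top[of 1] by eventually_elim (use n1 in force)
    show "\<forall>\<^sub>F m in sequentially. ln (real (n m)) / real m \<le> ln (real (n m)) * ln (real m) / real m"
      using eventually_ge_at_top[of 3]
    proof eventually_elim
      case (elim m)
      \<comment> \<open>From \<open>m = 3 > exp 1\<close> on, the factor \<open>ln m\<close> can be dropped.\<close>
      have "1 \<le> ln (real m)"
        using elim exp_le by (subst ln_ge_iff) auto
      then have "ln (real (n m)) * 1 \<le> ln (real (n m)) * ln (real m)"
        using n1[of m] elim by (intro mult_left_mono) auto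
      then show ?case by (simp add: divide_right_mono)
    qed
  qed
  let ?p = "\<lambda>m. measure (M m) {\<omega> \<in> space (M m).
    \<bar>max_weight (H m) (n m) (H m *\<^sub>v X m \<omega> + \<epsilon> m \<omega>) (\<lambda>i. S m i \<omega>) - 1\<bar> > e}"
  show "?p \<longlonglongrightarrow> 0"
  proof (rule order_tendstoI)
    fix \<eta> :: real assume "\<eta> < 0"
    then show "\<forall>\<^sub>F m in sequentially. \<eta> < ?p m"
      by (intro always_eventually allI) (rule less_le_trans[OF _ measure_nonneg])
  next
    fix \<eta> :: real assume \<eta>: "0 < \<eta>"
    \<comment> \<open>\<open>K\<close> and \<open>t\<close> make each of the two terms that do not tend to zero at most \<open>\<eta> / 4\<close>.\<close>
    define K where "K = 4 * (2 + 2 / \<delta>\<^sup>2) / \<eta>"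
    have K: "0 < K" using \<eta> \<delta>_pos by (simp add: K_def add_pos_nonneg)
    have K': "(2 + 2 / \<delta>\<^sup>2) / K = \<eta> / 4"
    proof -
      have "2 + 2 / \<delta>\<^sup>2 > 0" using \<delta>_pos by (simp add: add_pos_nonneg)
      then show ?thesis using \<eta> by (simp add: K_def divide_simps)
    qed
    define t where "t = min 1 (\<eta> * e * \<delta>\<^sup>2 / 16)"
    have t: "0 < t" "t \<le> 1" using \<eta> e \<delta>_pos by (auto simp: t_def)
    have "t \<le> \<eta> * e * \<delta>\<^sup>2 / 16" by (simp add: t_def)
    then have t': "4 * t / \<delta>\<^sup>2 \<le> \<eta> * e / 4" using \<delta>_pos by (simp add: field_simps)
    have "\<forall>\<^sub>F m in sequentially. real (n m) * single_error \<delta> t K m < \<eta> * e / 4"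
      using mult_single_error_tendsto_0[of n, OF n1 rate t(1) K] \<eta> e by (intro order_tendstoD) auto
    then show "\<forall>\<^sub>F m in sequentially. ?p m < \<eta>"
      using eventually_ge_at_top[of 1]
    proof eventually_elim
      case (elim m)
      have "?p m \<le> (2 + 2 / \<delta>\<^sup>2) / K + (4 * t / \<delta>\<^sup>2 + real (n m) * single_error \<delta> t K m) / e"
        by (rule gaussian_weighting_tail_bound[OF model[OF elim(2)] spectrum[OF elim(2)] _ \<delta>_pos _ t K e])
           (use elim A1 in \<open>auto intro: less_imp_le\<close>)
      also have "\<dots> \<le> \<eta> / 4 + (\<eta> * e / 4 + \<eta> * e / 4) / e"
        unfolding K' using t' elim(1) e by (intro add_left_mono divide_right_mono add_mono) auto
      also have "\<dots> < \<eta>" using \<eta> e by (simp add: field_simps)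
      finally show ?case .
    qed
  qed
qed

end
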